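(* Let $\mathcal A\subset B(\mathcal H)$ be the operator algebra constructed in the context, and let $\theta:\mathcal A^{**}\to B(\mathcal H)$ be the natural representation described there. Then $\theta$ is faithful (injective).
   Context: $\mathbb N=\{1,2,\dots\}$, $\mathbb N_0=\mathbb N\cup\{0\}$; $a\mid b$ means $a$ divides $b$ (so every $a\in\mathbb N$ divides $0$). Let $S$ be the free unital semigroup on two generators $g,h$, with unit $1$, and $S^-=S\setminus\{1\}$. For $s=\gamma_n\gamma_{n-1}\cdots\gamma_1$ with $\gamma_i\in\{g,h\}$, the length is $l(s)=n$, the depth is $\rho(s)=\#\{i:\gamma_i=h\}$, and, if $n>0$, the predecessor is $p(s)=\gamma_{n-1}\cdots\gamma_1$ (delete the leftmost letter); $p^j$ is the $j$-fold iterate of $p$. Weights: $w(s)=2^{-\rho(s)}$ and $W(s)=\prod_{j=0}^{l(s)-1}w(p^js)$ (so $W(1)=1$). $\mathcal H=l^2(S,W)$ is the Hilbert space of formal sums $\sum_{s\in S}x_s\cdot s$, $x_s\in\mathbb C$, with $\|\sum x_s\cdot s\|^2=\sum_{s\in S}W(s)^2|x_s|^2<\infty$; thus $S$ is an orthogonal basis with $\|s\|=W(s)$. Colour set: $\mathcal C=\{g^k:k\in\mathbb N\}\cup\{g^khs:k\in\mathbb N_0,\ s\in S,\ 1+l(s)\mid k\}\subset S^-$. The colour map $\mu:S^-\to\mathcal C$ is defined recursively: $\mu(s)=s$ if $s\in\mathcal C$; otherwise $s=g^khy$ with $y\in S$, $l(y)=n$, $(n+1)\nmid k$, and $\mu(s)=\mu(p^{n-k'}y)$,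 where $1\le k'\le n$ and $k\equiv k'\pmod{n+1}$. (For each $s\in S$, $\mu(gs)\ne\mu(hs)$.) For $c\in\mathcal C$, $T_c\in B(\mathcal H)$ is the bounded linear map with, for $s\in S$, $T_c(s)=gs$ if $\mu(gs)=c$, $T_c(s)=hs$ if $\mu(hs)=c$, and $T_c(s)=0$ otherwise. $\mathcal A_0$ is the non-unital subalgebra of $B(\mathcal H)$ generated by $\{T_c:c\in\mathcal C\}$, and $\mathcal A$ is its norm closure in $B(\mathcal H)$. $\mathcal A^{**}$ carries the Arens product (the two Arens products coincide because operator algebras are Arens regular). Let $\mathcal T$ be the trace class operators on $\mathcal H$, so $\mathcal T^*=B(\mathcal H)$ and $\mathcal T^{***}=B(\mathcal H)^{**}$. Let $\theta_0:\mathcal T^{***}\to\mathcal T^*=B(\mathcal H)$ be the natural projection (restriction of functionals on $\mathcal T^{**}$ to the canonical image of $\mathcal T$), which is an algebra homomorphism. Regarding $\mathcal A^{**}\subset B(\mathcal H)^{**}$, set $\theta=\theta_0|_{\mathcal A^{**}}$. Equivalently, if $\tau\in\mathcal A^{**}$ is a weak-* limit of a bounded net $T_\alpha\in\mathcal A$, then $\langle\theta(\tau)\eta,\zeta\rangle=\lim_\alpha\langle T_\alpha\eta,\zeta\rangle$ for all $\eta,\zeta\in\mathcal H$. *)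

theory Defs
  imports "HOL-Analysis.Analysis"
begin

section \<open>The free semigroup and its weights\<close>

datatype letter = Lg | Lh

text \<open>The word $\gamma_n \gamma_{n-1} \cdots \gamma_1$ is the list with head $\gamma_n$:
  the unit is the empty list, the product is append, $l(s)$ is \<^term>\<open>length s\<close>, and the
  predecessor $p$, which deletes the leftmost letter, is \<^const>\<open>tl\<close>.\<close>

type_synonym word = "letter list"

lemma tl_funpow: "(tl ^^ j) s = drop j s"
  by (induction j arbitrary: s) (simp_all add: drop_Suc tl_drop)

definition depth :: "word \<Rightarrow> nat" where
  "depth s = card {i. i < length s \<and> s ! i = Lh}"

definition wt :: "word \<Rightarrow> real" where
  "wt s = (1 / 2) ^ depth s"

definition Wt :: "word \<Rightarrow> real" where
  "Wt s = (\<Prod>j<length s. wt ((tl ^^ j) s))"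

lemma wt_pos: "0 < wt s"
  by (simp add: wt_def)

lemma wt_le_1: "wt s \<le> 1"
  by (simp add: wt_def power_le_one)

lemma Wt_pos [simp]: "0 < Wt s"
  by (simp add: Wt_def wt_pos prod_pos)

lemma Wt_nonneg [simp]: "0 \<le> Wt s"
  using Wt_pos[of s] by linarith

lemma Wt_nz [simp]: "Wt s \<noteq> 0"
  using Wt_pos[of s] by linarith

lemma Wt_Nil [simp]: "Wt [] = 1"
  by (simp add: Wt_def)

lemma Wt_Cons: "Wt (a # s) = wt (a # s) * Wt s"
  by (simp add: Wt_def tl_funpow prod.lessThan_Suc_shift del: prod.lessThan_Suc)

lemma Wt_Cons_le: "Wt (a # s) \<le> Wt s"
  using mult_right_mono[OF wt_le_1[of "a # s"] Wt_nonneg[of s]] by (simp add: Wt_Cons)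

section \<open>Colours\<close>

definition colours :: "word set" where
  "colours = {replicate k Lg | k. k \<ge> 1} \<union>
     {replicate k Lg @ Lh # s | k s. (1 + length s) dvd k}"

text \<open>A nonempty word outside \<^term>\<open>colours\<close> is uniquely $g^k h y$, where
  \<^term>\<open>gpow s\<close> is $k$ and \<^term>\<open>after_h s\<close> is $y$.\<close>

definition gpow :: "word \<Rightarrow> nat" where
  "gpow s = length (takeWhile (\<lambda>a. a = Lg) s)"

definition after_h :: "word \<Rightarrow> word" where
  "after_h s = tl (dropWhile (\<lambda>a. a = Lg) s)"

lemma gpow_after_h [simp]:
  "gpow (replicate k Lg @ Lh # y) = k" "after_h (replicate k Lg @ Lh # y) = y"
  by (simp_all add: gpow_def after_h_def takeWhile_append dropWhile_append)

lemma length_after_h: "s \<noteq> [] \<Longrightarrow> length (after_h s) < length s"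
  unfolding after_h_def length_tl using length_dropWhile_le[of "\<lambda>a. a = Lg" s]
  by (cases s) (auto simp: less_Suc_eq_le)

text \<open>Only the values of \<open>colour\<close> on nonempty words are meaningful. When $n+1$ does not
  divide $k$, the number $k'$ with $1 \le k' \le n$ and $k \equiv k'$ mod $n+1$
  is \<^term>\<open>k mod (n + 1)\<close>.\<close>

function colour :: "word \<Rightarrow> word" where
  "colour s = (if s = [] \<or> s \<in> colours then s else
     (let k = gpow s; y = after_h s; n = length y; k' = k mod (n + 1)
      in colour ((tl ^^ (n - k')) y)))"
  by auto
termination
  by (relation "Wellfounded.measure length")
    (auto simp: tl_funpow intro: le_less_trans[OF _ length_after_h])

declare colour.simps [simp del]

lemma colour_colour: "s \<in> colours \<Longrightarrow> colour s = s"
  by (subst colour.simps) simp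

lemma colour_rec:
  assumes "s = replicate k Lg @ Lh # y" "length y = n" "\<not> (n + 1) dvd k"
    and "1 \<le> k'" "k' \<le> n" "k mod (n + 1) = k' mod (n + 1)"
  shows "colour s = colour ((tl ^^ (n - k')) y)"
proof -
  have "s \<notin> colours"
  proof
    assume "s \<in> colours"
    then consider j where "s = replicate j Lg"
      | j z where "s = replicate j Lg @ Lh # z" "(1 + length z) dvd j"
      by (auto simp: colours_def)
    then show False
    proof cases
      case 1
      have "Lh \<in> set s" by (simp add: assms(1))
      with 1 show False by simp
    next
      case 2
      then have "gpow s = j" "after_h s = z" by simp_all
      moreover have "gpow s = k" "after_h s = y" by (simp_all add: assms(1))
      ultimately show False using 2 assms by simp
    qed
  qed
  moreover have "k' mod (n + 1) = k'" using assms by simp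
  ultimately show ?thesis
    using assms by (subst colour.simps) (simp add: Let_def)
qed

lemma word_cases:
  obtains k where "s = replicate k Lg" | k y where "s = replicate k Lg @ Lh # y"
proof (induction s arbitrary: thesis)
  case Nil
  show ?case by (rule Nil(1)[of 0]) simp
next
  case (Cons a s)
  show ?case
  proof (cases a)
    case Lg
    show ?thesis
    proof (rule Cons.IH)
      fix k assume "s = replicate k Lg"
      then show thesis using Lg by (intro Cons.prems(1)[of "Suc k"]) simp
    next
      fix k y assume "s = replicate k Lg @ Lh # y"
      then show thesis using Lg by (intro Cons.prems(2)[of "Suc k" y]) simp
    qed
  next
    case Lh
    then show ?thesis by (intro Cons.prems(2)[of 0 s]) simp
  qed
qed

lemma not_colour_cases:
  assumes "s \<noteq> []" "s \<notin> colours"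
  obtains k y where "s = replicate k Lg @ Lh # y"
proof (cases rule: word_cases[of s])
  case (1 k)
  then have "k \<ge> 1" using assms(1) by (cases k) auto
  with 1 assms(2) show ?thesis by (auto simp: colours_def)
qed

lemma colour_in_colours: "s \<noteq> [] \<Longrightarrow> colour s \<in> colours \<and> length (colour s) \<le> length s"
proof (induction s rule: length_induct)
  case (1 s)
  show ?case
  proof (cases "s \<in> colours")
    case False
    then obtain k y where s: "s = replicate k Lg @ Lh # y"
      using not_colour_cases[OF \<open>s \<noteq> []\<close>] by blast
    let ?n = "length y"
    have nd: "\<not> (?n + 1) dvd k" using False s by (auto simp: colours_def)
    let ?k = "k mod (?n + 1)"
    have k: "1 \<le> ?k" using nd by (simp add: dvd_eq_mod_eq_0)
    have k': "?k \<le> ?n" using mod_less_divisor[of "?n + 1" k] by linarith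
    have eq: "colour s = colour ((tl ^^ (?n - ?k)) y)"
      by (rule colour_rec[OF s refl nd k k']) simp
    have "length ((tl ^^ (?n - ?k)) y) < length s"
      by (simp add: tl_funpow s less_Suc_eq_le trans_le_add2)
    moreover have "(tl ^^ (?n - ?k)) y \<noteq> []"
      using k k' unfolding tl_funpow drop_eq_Nil by linarith
    ultimately show ?thesis using 1(1) unfolding eq by fastforce
  qed (simp add: colour_colour)
qed

lemma colour_h: "colour (Lh # s) = Lh # s"
  by (rule colour_colour) (auto simp: colours_def intro: exI[of _ 0])

lemma colour_ne: "colour (Lg # s) \<noteq> colour (Lh # s)"
proof (cases "Lg # s \<in> colours")
  case True
  then show ?thesis by (simp add: colour_h colour_colour)
next
  case False
  then obtain k y where s: "Lg # s = replicate k Lg @ Lh # y"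
    using not_colour_cases[of "Lg # s"] by blast
  let ?n = "length y"
  have nd: "\<not> (?n + 1) dvd k" using False s by (auto simp: colours_def)
  let ?k = "k mod (?n + 1)"
  have k: "1 \<le> ?k" using nd by (simp add: dvd_eq_mod_eq_0)
  have k': "?k \<le> ?n" using mod_less_divisor[of "?n + 1" k] by linarith
  have eq: "colour (Lg # s) = colour ((tl ^^ (?n - ?k)) y)"
    by (rule colour_rec[OF s refl nd k k']) simp
  have "(tl ^^ (?n - ?k)) y \<noteq> []"
    using k k' unfolding tl_funpow drop_eq_Nil by linarith
  from colour_in_colours[OF this] have "length (colour (Lg # s)) \<le> length y"
    unfolding eq using le_trans by (fastforce simp: tl_funpow)
  moreover have "length y < length (Lg # s)" by (simp add: s)
  ultimately show ?thesis by (metis colour_h length_Cons not_less)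
qed

section \<open>The Hilbert space\<close>

typedef hilb = "{x :: word \<Rightarrow> complex. (\<lambda>s. (Wt s)\<^sup>2 * (cmod (x s))\<^sup>2) summable_on UNIV}"
  morphisms coef Abs_hilb
  by (rule exI[of _ "\<lambda>_. 0"]) simp

setup_lifting type_definition_hilb

lemma coef_summable: "(\<lambda>s. (Wt s)\<^sup>2 * (cmod (coef x s))\<^sup>2) summable_on UNIV"
  using coef[of x] by simp

lemma summable_add_aux:
  assumes "(\<lambda>s. (Wt s)\<^sup>2 * (cmod (x s))\<^sup>2) summable_on UNIV"
    and "(\<lambda>s. (Wt s)\<^sup>2 * (cmod (y s))\<^sup>2) summable_on UNIV"
  shows "(\<lambda>s. (Wt s)\<^sup>2 * (cmod (x s + y s))\<^sup>2) summable_on UNIV"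
proof (rule summable_on_comparison_test)
  show "(\<lambda>s. 2 * ((Wt s)\<^sup>2 * (cmod (x s))\<^sup>2 + (Wt s)\<^sup>2 * (cmod (y s))\<^sup>2)) summable_on UNIV"
    by (intro summable_on_cmult_right summable_on_add assms)
  fix s
  have "(cmod (x s + y s))\<^sup>2 \<le> (cmod (x s) + cmod (y s))\<^sup>2"
    by (intro power_mono norm_triangle_ineq) simp
  also have "\<dots> \<le> 2 * ((cmod (x s))\<^sup>2 + (cmod (y s))\<^sup>2)"
    using sum_squares_bound[of "cmod (x s)" "cmod (y s)"] by (simp add: power2_sum)
  finally have "(Wt s)\<^sup>2 * (cmod (x s + y s))\<^sup>2
      \<le> (Wt s)\<^sup>2 * (2 * ((cmod (x s))\<^sup>2 + (cmod (y s))\<^sup>2))"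
    by (rule mult_left_mono) simp
  then show "(Wt s)\<^sup>2 * (cmod (x s + y s))\<^sup>2
      \<le> 2 * ((Wt s)\<^sup>2 * (cmod (x s))\<^sup>2 + (Wt s)\<^sup>2 * (cmod (y s))\<^sup>2)"
    by (simp add: algebra_simps)
qed simp

lemma summable_cmult_aux:
  fixes c :: complex
  assumes "(\<lambda>s. (Wt s)\<^sup>2 * (cmod (x s))\<^sup>2) summable_on UNIV"
  shows "(\<lambda>s. (Wt s)\<^sup>2 * (cmod (c * x s))\<^sup>2) summable_on UNIV"
  using summable_on_cmult_right[OF assms, of "(cmod c)\<^sup>2"]
  by (simp add: norm_mult power_mult_distrib algebra_simps)

lemma summable_prod_aux:
  "(\<lambda>s. cmod (complex_of_real ((Wt s)\<^sup>2) * coef x s * cnj (coef y s))) summable_on UNIV"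
proof (rule summable_on_comparison_test)
  show "(\<lambda>s. (Wt s)\<^sup>2 * (cmod (coef x s))\<^sup>2 + (Wt s)\<^sup>2 * (cmod (coef y s))\<^sup>2) summable_on UNIV"
    by (intro summable_on_add coef_summable)
  fix s
  have "cmod (coef x s) * cmod (coef y s) \<le> (cmod (coef x s))\<^sup>2 + (cmod (coef y s))\<^sup>2"
    using sum_squares_bound[of "cmod (coef x s)" "cmod (coef y s)"]
      mult_nonneg_nonneg[OF norm_ge_zero[of "coef x s"] norm_ge_zero[of "coef y s"]] by linarith
  from mult_left_mono[OF this, of "(Wt s)\<^sup>2"]
  show "cmod (complex_of_real ((Wt s)\<^sup>2) * coef x s * cnj (coef y s))
      \<le> (Wt s)\<^sup>2 * (cmod (coef x s))\<^sup>2 + (Wt s)\<^sup>2 * (cmod (coef y s))\<^sup>2"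
    by (simp add: norm_mult norm_power algebra_simps)
qed simp

definition cinner :: "hilb \<Rightarrow> hilb \<Rightarrow> complex" where
  "cinner x y = (\<Sum>\<^sub>\<infinity>s. complex_of_real ((Wt s)\<^sup>2) * coef x s * cnj (coef y s))"

lemma cinner_summable:
  "(\<lambda>s. complex_of_real ((Wt s)\<^sup>2) * coef x s * cnj (coef y s)) summable_on UNIV"
  by (rule abs_summable_summable[OF summable_prod_aux])

lemma hilb_eqI: "(\<And>s. coef x s = coef y s) \<Longrightarrow> x = y"
  by (rule iffD1[OF coef_inject]) (rule ext)

instantiation hilb :: real_vector
begin

lift_definition zero_hilb :: hilb is "\<lambda>_. 0" by simp
lift_definition plus_hilb :: "hilb \<Rightarrow> hilb \<Rightarrow> hilb" is "\<lambda>x y s. x s + y s"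
  by (simp add: summable_add_aux)
lift_definition uminus_hilb :: "hilb \<Rightarrow> hilb" is "\<lambda>x s. - x s" by simp
lift_definition scaleR_hilb :: "real \<Rightarrow> hilb \<Rightarrow> hilb" is "\<lambda>r x s. complex_of_real r * x s"
  using summable_cmult_aux by simp
definition minus_hilb :: "hilb \<Rightarrow> hilb \<Rightarrow> hilb" where
  "minus_hilb x y = x + (- y)"

lemma coef_vector_simps:
  "coef 0 s = 0" "coef (x + y) s = coef x s + coef y s" "coef (- x) s = - coef x s"
  "coef (x - y) s = coef x s - coef y s" "coef (scaleR r x) s = complex_of_real r * coef x s"
  by (simp_all add: minus_hilb_def zero_hilb.rep_eq plus_hilb.rep_eq uminus_hilb.rep_eq
      scaleR_hilb.rep_eq)

instance
  by standard (rule hilb_eqI, simp add: coef_vector_simps algebra_simps)+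

end

lift_definition scaleC :: "complex \<Rightarrow> hilb \<Rightarrow> hilb" is "\<lambda>c x s. c * x s"
  using summable_cmult_aux by simp

declare coef_vector_simps [simp]

lemma coef_scaleC [simp]: "coef (scaleC c x) s = c * coef x s"
  by (simp add: scaleC.rep_eq)

lemma coef_sum [simp]: "coef (\<Sum>i\<in>I. f i) s = (\<Sum>i\<in>I. coef (f i) s)"
  by (induction I rule: infinite_finite_induct) auto

lemma cinner_add_left: "cinner (x + y) z = cinner x z + cinner y z"
  unfolding cinner_def infsum_add[OF cinner_summable cinner_summable, symmetric]
  by (simp add: algebra_simps)

lemma cinner_scaleC_left: "cinner (scaleC c x) z = c * cinner x z"
  unfolding cinner_def by (simp add: infsum_cmult_right'[symmetric] algebra_simps)

lemma cinner_commute: "cinner y x = cnj (cinner x y)"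
  unfolding cinner_def infsum_cnj[symmetric] by (simp add: algebra_simps)

lemma scaleR_scaleC: "scaleR r x = scaleC (complex_of_real r) x"
  by (rule hilb_eqI) simp

lemma cinner_self: "cinner x x = complex_of_real (\<Sum>\<^sub>\<infinity>s. (Wt s)\<^sup>2 * (cmod (coef x s))\<^sup>2)"
proof -
  have "((\<lambda>s. complex_of_real ((Wt s)\<^sup>2 * (cmod (coef x s))\<^sup>2)) has_sum
      complex_of_real (\<Sum>\<^sub>\<infinity>s. (Wt s)\<^sup>2 * (cmod (coef x s))\<^sup>2)) UNIV"
    by (intro has_sum_of_real has_sum_infsum coef_summable)
  then show ?thesis
    unfolding cinner_def by (intro infsumI) (simp only: of_real_mult complex_norm_square mult.assoc)
qed

text \<open>The norm is that of $l^2(S,W)$. The type class gives the underlying real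
  Hilbert space structure; complex scalars act through \<^const>\<open>scaleC\<close>.\<close>

instantiation hilb :: real_inner
begin

definition inner_hilb :: "hilb \<Rightarrow> hilb \<Rightarrow> real" where
  "inner_hilb x y = Re (cinner x y)"
definition norm_hilb :: "hilb \<Rightarrow> real" where
  "norm_hilb x = sqrt (\<Sum>\<^sub>\<infinity>s. (Wt s)\<^sup>2 * (cmod (coef x s))\<^sup>2)"
definition dist_hilb :: "hilb \<Rightarrow> hilb \<Rightarrow> real" where
  "dist_hilb x y = norm (x - y)"
definition sgn_hilb :: "hilb \<Rightarrow> hilb" where
  "sgn_hilb x = x /\<^sub>R norm x"
definition uniformity_hilb :: "(hilb \<times> hilb) filter" where
  "uniformity_hilb = (INF e\<in>{0<..}. principal {(x, y). dist x y < e})"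
definition open_hilb :: "hilb set \<Rightarrow> bool" where
  "open_hilb U \<longleftrightarrow> (\<forall>x\<in>U. eventually (\<lambda>(x', y). x' = x \<longrightarrow> y \<in> U) uniformity)"

instance
proof
  fix x y z :: hilb and r :: real
  show "inner x y = inner y x"
    by (simp add: inner_hilb_def cinner_commute[of x y])
  show "inner (x + y) z = inner x z + inner y z"
    by (simp add: inner_hilb_def cinner_add_left)
  show "inner (scaleR r x) y = r * inner x y"
    by (simp add: inner_hilb_def scaleR_scaleC cinner_scaleC_left)
  show "0 \<le> inner x x"
    by (simp add: inner_hilb_def cinner_self infsum_nonneg)
  show "norm x = sqrt (inner x x)"
    by (simp add: inner_hilb_def cinner_self norm_hilb_def)
  show "(inner x x = 0) = (x = 0)"
  proof
    assume "inner x x = 0"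
    then have *: "(\<Sum>\<^sub>\<infinity>s. (Wt s)\<^sup>2 * (cmod (coef x s))\<^sup>2) = 0"
      by (simp add: inner_hilb_def cinner_self)
    have "(Wt s)\<^sup>2 * (cmod (coef x s))\<^sup>2 = 0" for s
      by (rule nonneg_infsum_le_0D[OF _ coef_summable]) (simp_all add: *)
    then show "x = 0" by (intro hilb_eqI) simp
  qed (simp add: inner_hilb_def cinner_def)
qed (simp_all add: dist_hilb_def sgn_hilb_def uniformity_hilb_def open_hilb_def)

end

lift_definition basis :: "word \<Rightarrow> hilb" is "\<lambda>s t. if t = s then 1 else 0"
proof -
  fix s
  have "(\<lambda>t. (Wt t)\<^sup>2 * (cmod (if t = s then 1 else 0))\<^sup>2) summable_on UNIV \<longleftrightarrow>
      (\<lambda>t. (Wt t)\<^sup>2 * (cmod (if t = s then 1 else 0))\<^sup>2) summable_on {s}"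
    by (rule summable_on_cong_neutral) auto
  then show "(\<lambda>t. (Wt t)\<^sup>2 * (cmod (if t = s then 1 else 0))\<^sup>2) summable_on UNIV" by simp
qed

lemma coef_basis [simp]: "coef (basis s) t = (if t = s then 1 else 0)"
  by transfer simp

lemma norm_sq: "(norm x)\<^sup>2 = (\<Sum>\<^sub>\<infinity>s. (Wt s)\<^sup>2 * (cmod (coef x s))\<^sup>2)"
  by (simp add: norm_hilb_def infsum_nonneg)

lemma infsum_single: "(\<Sum>\<^sub>\<infinity>t. if t = s then f t else 0) = (f s :: 'a :: {comm_monoid_add,t2_space})"
proof -
  have "(\<Sum>\<^sub>\<infinity>t. if t = s then f t else 0) = (\<Sum>\<^sub>\<infinity>t\<in>{s}. f t)"
    by (rule infsum_cong_neutral) auto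
  then show ?thesis by simp
qed

lemma norm_basis: "norm (basis s) = Wt s"
proof -
  have "(norm (basis s))\<^sup>2 = (\<Sum>\<^sub>\<infinity>t. if t = s then (Wt t)\<^sup>2 else 0)"
    unfolding norm_sq by (intro infsum_cong) simp
  then show ?thesis by (simp add: infsum_single)
qed

lemma cinner_basis_right: "cinner x (basis s) = complex_of_real ((Wt s)\<^sup>2) * coef x s"
proof -
  have "cinner x (basis s) = (\<Sum>\<^sub>\<infinity>t. if t = s then complex_of_real ((Wt t)\<^sup>2) * coef x t else 0)"
    unfolding cinner_def by (intro infsum_cong) simp
  then show ?thesis by (simp add: infsum_single)
qed

lemma norm_scaleC: "norm (scaleC c x) = cmod c * norm x"
proof -
  have "(norm (scaleC c x))\<^sup>2 = (cmod c * norm x)\<^sup>2"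
    unfolding power_mult_distrib norm_sq infsum_cmult_right'[symmetric]
    by (intro infsum_cong) (simp add: norm_mult power_mult_distrib)
  then show ?thesis by (rule power2_eq_imp_eq) simp_all
qed

lemma scaleC_add_right: "scaleC c (x + y) = scaleC c x + scaleC c y"
  by (rule hilb_eqI) (simp add: algebra_simps)

lemma bounded_linear_scaleC: "bounded_linear (scaleC c)"
proof (rule bounded_linear_intro[of _ "cmod c"])
  show "scaleC c (r *\<^sub>R x) = r *\<^sub>R scaleC c x" for r x
    by (rule hilb_eqI) simp
qed (simp_all add: scaleC_add_right norm_scaleC mult.commute)

lemma cmod_cinner_le: "cmod (cinner x y) \<le> norm x * norm y"
proof (cases "cinner x y = 0")
  case False
  define c where "c = cnj (sgn (cinner x y))"
  have "c * cinner x y = (cinner x y * cnj (cinner x y)) / complex_of_real (cmod (cinner x y))"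
    by (simp add: c_def sgn_eq)
  also have "\<dots> = complex_of_real ((cmod (cinner x y))\<^sup>2 / cmod (cinner x y))"
    by (simp only: complex_norm_square[symmetric] of_real_divide)
  also have "(cmod (cinner x y))\<^sup>2 / cmod (cinner x y) = cmod (cinner x y)"
    by (simp add: power2_eq_square)
  finally have "c * cinner x y = complex_of_real (cmod (cinner x y))" .
  then have "cmod (cinner x y) = Re (cinner (scaleC c x) y)"
    by (simp add: cinner_scaleC_left)
  also have "\<dots> = inner (scaleC c x) y" by (simp add: inner_hilb_def)
  also have "\<dots> \<le> norm (scaleC c x) * norm y" by (rule norm_cauchy_schwarz)
  also have "norm (scaleC c x) = norm x"
    using False by (simp add: norm_scaleC c_def norm_sgn)
  finally show ?thesis .
qed simp

lemma hilb_expansion: "((\<lambda>s. scaleC (coef x s) (basis s)) has_sum x) UNIV"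
  unfolding has_sum_def tendsto_iff
proof (intro allI impI)
  fix e :: real assume e: "e > 0"
  define f where "f s = (Wt s)\<^sup>2 * (cmod (coef x s))\<^sup>2" for s
  have f: "(f has_sum (norm x)\<^sup>2) UNIV"
    unfolding norm_sq f_def by (intro has_sum_infsum coef_summable)
  have nrm: "(norm ((\<Sum>s\<in>F. scaleC (coef x s) (basis s)) - x))\<^sup>2 = (norm x)\<^sup>2 - sum f F"
    if F: "finite F" for F
  proof -
    let ?z = "(\<Sum>s\<in>F. scaleC (coef x s) (basis s)) - x"
    have c: "coef ?z t = (if t \<in> F then 0 else - coef x t)" for t
      using F by (simp add: if_distrib[of "\<lambda>u. _ * u"] sum.delta' cong: if_cong)
    have "(norm ?z)\<^sup>2 = (\<Sum>\<^sub>\<infinity>s. if s \<in> F then 0 else f s)"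
      unfolding norm_sq by (intro infsum_cong) (simp only: c f_def, simp)
    also have "\<dots> = infsum f (UNIV - F)"
      by (rule infsum_cong_neutral) auto
    also have "\<dots> = infsum f UNIV - infsum f F"
      using f F by (intro infsum_Diff) (auto intro: has_sum_imp_summable)
    finally show ?thesis using F infsumI[OF f] by simp
  qed
  have "eventually (\<lambda>F. dist (sum f F) ((norm x)\<^sup>2) < e\<^sup>2) (finite_subsets_at_top UNIV)"
    using f e unfolding has_sum_def tendsto_iff by simp
  moreover have "eventually finite (finite_subsets_at_top (UNIV :: word set))"
    by (auto simp: eventually_finite_subsets_at_top)
  ultimately show "eventually (\<lambda>F. dist (\<Sum>s\<in>F. scaleC (coef x s) (basis s)) x < e)
      (finite_subsets_at_top UNIV)"
  proof eventually_elim
    case (elim F)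
    then have "(norm ((\<Sum>s\<in>F. scaleC (coef x s) (basis s)) - x))\<^sup>2 < e\<^sup>2"
      by (simp add: nrm dist_real_def abs_if split: if_splits)
    then show ?case unfolding dist_norm by (rule power2_less_imp_less) (use e in simp)
  qed
qed

section \<open>Operators and the algebra\<close>

lift_definition scalar_op :: "complex \<Rightarrow> hilb \<Rightarrow>\<^sub>L hilb" is scaleC
  by (rule bounded_linear_scaleC)

definition scaleC_op :: "complex \<Rightarrow> (hilb \<Rightarrow>\<^sub>L hilb) \<Rightarrow> (hilb \<Rightarrow>\<^sub>L hilb)" where
  "scaleC_op c T = scalar_op c o\<^sub>L T"

lemma scaleC_op_apply [simp]: "blinfun_apply (scaleC_op c T) x = scaleC c (blinfun_apply T x)"
  by (simp add: scaleC_op_def scalar_op.rep_eq)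

text \<open>Elements of \<^typ>\<open>hilb \<Rightarrow>\<^sub>L hilb\<close> are only real linear; its norm is the operator norm.\<close>

definition BH :: "(hilb \<Rightarrow>\<^sub>L hilb) set" where
  "BH = {T. \<forall>c x. blinfun_apply T (scaleC c x) = scaleC c (blinfun_apply T x)}"

text \<open>By \<open>T_op_exists1\<close> below, this operator exists and is unique.\<close>

definition T_op :: "word \<Rightarrow> (hilb \<Rightarrow>\<^sub>L hilb)" where
  "T_op c = (THE T. T \<in> BH \<and> (\<forall>s.
     (colour (Lg # s) = c \<longrightarrow> blinfun_apply T (basis s) = basis (Lg # s)) \<and>
     (colour (Lh # s) = c \<longrightarrow> blinfun_apply T (basis s) = basis (Lh # s)) \<and>
     (colour (Lg # s) \<noteq> c \<and> colour (Lh # s) \<noteq> c \<longrightarrow> blinfun_apply T (basis s) = 0)))"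

lemma BH_scaleC: "T \<in> BH \<Longrightarrow> blinfun_apply T (scaleC c x) = scaleC c (blinfun_apply T x)"
  by (simp add: BH_def)

lemma bounded_linear_ext:
  fixes f g :: "hilb \<Rightarrow> 'b :: real_normed_vector"
  assumes "bounded_linear f" "bounded_linear g"
    and "\<And>c s. f (scaleC c (basis s)) = g (scaleC c (basis s))"
  shows "f x = g x"
proof (rule has_sum_unique)
  show "((\<lambda>s. g (scaleC (coef x s) (basis s))) has_sum f x) UNIV"
    using has_sum_bounded_linear[OF assms(1) hilb_expansion[of x]] by (simp add: assms(3) o_def)
  show "((\<lambda>s. g (scaleC (coef x s) (basis s))) has_sum g x) UNIV"
    using has_sum_bounded_linear[OF assms(2) hilb_expansion[of x]] by (simp add: o_def)
qed

lemma BH_eqI: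
  assumes "S \<in> BH" "T \<in> BH" "\<And>s. blinfun_apply S (basis s) = blinfun_apply T (basis s)"
  shows "S = T"
  by (rule blinfun_eqI, rule bounded_linear_ext[OF blinfun.bounded_linear_right blinfun.bounded_linear_right])
    (simp add: BH_scaleC assms)

lemma T_sum_aux:
  assumes "finite F"
  shows "(\<Sum>t\<in>F. (Wt t)\<^sup>2 * (cmod (if t \<noteq> [] \<and> colour t = c then coef x (tl t) else 0))\<^sup>2)
    \<le> (norm x)\<^sup>2"
proof -
  let ?G = "{t \<in> F. t \<noteq> [] \<and> colour t = c}"
  let ?f = "\<lambda>s. (Wt s)\<^sup>2 * (cmod (coef x s))\<^sup>2"
  have inj: "inj_on tl ?G"
  proof (rule inj_onI)
    fix t u assume *: "t \<in> ?G" "u \<in> ?G" "tl t = tl u"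
    then obtain a b s where "t = a # s" "u = b # s" by (cases t; cases u) auto
    with * colour_ne[of s] show "t = u" by (cases a; cases b) auto
  qed
  have "(\<Sum>t\<in>F. (Wt t)\<^sup>2 * (cmod (if t \<noteq> [] \<and> colour t = c then coef x (tl t) else 0))\<^sup>2)
      = (\<Sum>t\<in>?G. (Wt t)\<^sup>2 * (cmod (coef x (tl t)))\<^sup>2)"
    by (rule sum.mono_neutral_cong_right) (use assms in auto)
  also have "\<dots> \<le> (\<Sum>t\<in>?G. ?f (tl t))"
  proof (rule sum_mono)
    fix t assume "t \<in> ?G"
    then have "Wt t \<le> Wt (tl t)" using Wt_Cons_le by (cases t) auto
    then show "(Wt t)\<^sup>2 * (cmod (coef x (tl t)))\<^sup>2 \<le> ?f (tl t)"
      by (intro mult_right_mono power_mono) auto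
  qed
  also have "\<dots> = sum ?f (tl ` ?G)"
    by (simp add: sum.reindex[OF inj])
  also have "\<dots> \<le> (norm x)\<^sup>2"
    unfolding norm_sq by (rule finite_sum_le_infsum) (use assms coef_summable in auto)
  finally show ?thesis .
qed

lift_definition T_fun :: "word \<Rightarrow> hilb \<Rightarrow> hilb" is
  "\<lambda>c x t. if t \<noteq> [] \<and> colour t = c then x (tl t) else 0"
proof -
  fix c and x :: "word \<Rightarrow> complex"
  assume "(\<lambda>s. (Wt s)\<^sup>2 * (cmod (x s))\<^sup>2) summable_on UNIV"
  then have x: "coef (Abs_hilb x) = x" by (simp add: Abs_hilb_inverse)
  show "(\<lambda>t. (Wt t)\<^sup>2 * (cmod (if t \<noteq> [] \<and> colour t = c then x (tl t) else 0))\<^sup>2) summable_on UNIV"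
    using T_sum_aux[where x = "Abs_hilb x" and c = c, unfolded x]
    by (intro nonneg_bdd_above_summable_on bdd_aboveI2) auto
qed

lemma coef_T_fun: "coef (T_fun c x) t = (if t \<noteq> [] \<and> colour t = c then coef x (tl t) else 0)"
  by transfer simp

lemma norm_T_fun: "norm (T_fun c x) \<le> norm x"
proof -
  have "(norm (T_fun c x))\<^sup>2 \<le> (norm x)\<^sup>2"
    unfolding norm_sq[of "T_fun c x"]
    by (rule infsum_le_finite_sums[OF coef_summable]) (simp only: coef_T_fun T_sum_aux)
  then show ?thesis by (rule power2_le_imp_le) simp
qed

lemma bounded_linear_T_fun: "bounded_linear (T_fun c)"
  by (rule bounded_linear_intro[of _ 1])
    (auto intro!: hilb_eqI simp: coef_T_fun norm_T_fun)

lemma T_op_exists1: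
  "\<exists>!T. T \<in> BH \<and> (\<forall>s.
     (colour (Lg # s) = c \<longrightarrow> blinfun_apply T (basis s) = basis (Lg # s)) \<and>
     (colour (Lh # s) = c \<longrightarrow> blinfun_apply T (basis s) = basis (Lh # s)) \<and>
     (colour (Lg # s) \<noteq> c \<and> colour (Lh # s) \<noteq> c \<longrightarrow> blinfun_apply T (basis s) = 0))"
  (is "\<exists>!T. ?P T")
proof (rule ex_ex1I)
  have app: "blinfun_apply (Blinfun (T_fun c)) = T_fun c"
    by (rule bounded_linear_Blinfun_apply[OF bounded_linear_T_fun])
  have "T_fun c (basis s) = basis (a # s)" if "colour (a # s) = c" for a s
  proof (rule hilb_eqI)
    fix t
    have "t \<noteq> [] \<and> colour t = c \<and> tl t = s \<longleftrightarrow> t = a # s"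
    proof
      assume t: "t \<noteq> [] \<and> colour t = c \<and> tl t = s"
      then obtain b where "t = b # s" by (cases t) auto
      with t \<open>colour (a # s) = c\<close> colour_ne[of s] show "t = a # s" by (cases a; cases b) auto
    qed (use that in simp)
    then show "coef (T_fun c (basis s)) t = coef (basis (a # s)) t"
      unfolding coef_T_fun coef_basis by meson
  qed
  moreover have "T_fun c (basis s) = 0"
    if "colour (Lg # s) \<noteq> c" "colour (Lh # s) \<noteq> c" for s
  proof (rule hilb_eqI)
    fix t
    have "colour t \<noteq> c" if t: "t \<noteq> []" "tl t = s"
    proof -
      obtain b where "t = b # s" using t by (cases t) auto
      with \<open>colour (Lg # s) \<noteq> c\<close> \<open>colour (Lh # s) \<noteq> c\<close> show ?thesis by (cases b) auto
    qed
    then show "coef (T_fun c (basis s)) t = coef 0 t" by (auto simp: coef_T_fun)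
  qed
  moreover have "Blinfun (T_fun c) \<in> BH"
    by (auto simp: BH_def app coef_T_fun intro!: hilb_eqI)
  ultimately show "\<exists>T. ?P T" by (intro exI[of _ "Blinfun (T_fun c)"]) (simp add: app)
next
  fix S T assume "?P S" "?P T"
  then show "S = T" by (intro BH_eqI) metis+
qed

lemma T_op:
  shows T_op_BH: "T_op c \<in> BH"
    and T_op_g: "colour (Lg # s) = c \<Longrightarrow> blinfun_apply (T_op c) (basis s) = basis (Lg # s)"
    and T_op_h: "colour (Lh # s) = c \<Longrightarrow> blinfun_apply (T_op c) (basis s) = basis (Lh # s)"
    and T_op_0: "colour (Lg # s) \<noteq> c \<Longrightarrow> colour (Lh # s) \<noteq> c \<Longrightarrow>
      blinfun_apply (T_op c) (basis s) = 0"
  using theI'[OF T_op_exists1[of c]] unfolding T_op_def[symmetric] by blast+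

inductive_set Alg0 :: "(hilb \<Rightarrow>\<^sub>L hilb) set" where
  gen: "c \<in> colours \<Longrightarrow> T_op c \<in> Alg0"
| add: "S \<in> Alg0 \<Longrightarrow> T \<in> Alg0 \<Longrightarrow> S + T \<in> Alg0"
| scale: "T \<in> Alg0 \<Longrightarrow> scaleC_op c T \<in> Alg0"
| mult: "S \<in> Alg0 \<Longrightarrow> T \<in> Alg0 \<Longrightarrow> S o\<^sub>L T \<in> Alg0"

definition Alg :: "(hilb \<Rightarrow>\<^sub>L hilb) set" where
  "Alg = closure Alg0"

section \<open>The bidual of the algebra\<close>

text \<open>Functionals on \<open>Alg\<close> and on its dual are represented by total functions that vanish
  off their domain, so that equality of representatives is equality of functionals.\<close>

definition Alg_dual :: "((hilb \<Rightarrow>\<^sub>L hilb) \<Rightarrow> complex) set" where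
  "Alg_dual = {f. (\<forall>a. a \<notin> Alg \<longrightarrow> f a = 0) \<and>
     (\<forall>a\<in>Alg. \<forall>b\<in>Alg. f (a + b) = f a + f b) \<and>
     (\<forall>c. \<forall>a\<in>Alg. f (scaleC_op c a) = c * f a) \<and>
     (\<exists>K. \<forall>a\<in>Alg. cmod (f a) \<le> K * norm a)}"

definition Alg_dual_norm :: "((hilb \<Rightarrow>\<^sub>L hilb) \<Rightarrow> complex) \<Rightarrow> real" where
  "Alg_dual_norm f = (SUP a\<in>{a \<in> Alg. norm a \<le> 1}. cmod (f a))"

definition Alg_bidual :: "(((hilb \<Rightarrow>\<^sub>L hilb) \<Rightarrow> complex) \<Rightarrow> complex) set" where
  "Alg_bidual = {\<tau>. (\<forall>f. f \<notin> Alg_dual \<longrightarrow> \<tau> f = 0) \<and>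
     (\<forall>f\<in>Alg_dual. \<forall>f'\<in>Alg_dual. \<tau> (\<lambda>a. f a + f' a) = \<tau> f + \<tau> f') \<and>
     (\<forall>c. \<forall>f\<in>Alg_dual. \<tau> (\<lambda>a. c * f a) = c * \<tau> f) \<and>
     (\<exists>K. \<forall>f\<in>Alg_dual. cmod (\<tau> f) \<le> K * Alg_dual_norm f)}"

section \<open>Trace class operators and the natural representation\<close>

text \<open>The trace class operators, given by their nuclear expansions
  $t = \sum_n \langle \cdot, \zeta_n\rangle \eta_n$ with
  $\sum_n \|\eta_n\| \|\zeta_n\| < \infty$.\<close>

definition trace_class :: "(hilb \<Rightarrow>\<^sub>L hilb) set" where
  "trace_class = {t \<in> BH. \<exists>\<eta> \<zeta> :: nat \<Rightarrow> hilb. summable (\<lambda>n. norm (\<eta> n) * norm (\<zeta> n)) \<and>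
     (\<forall>x. (\<lambda>n. scaleC (cinner x (\<zeta> n)) (\<eta> n)) sums blinfun_apply t x)}"

text \<open>The division normalises the orthogonal basis, whose vectors have norm \<^term>\<open>Wt s\<close>.\<close>

definition op_trace :: "(hilb \<Rightarrow>\<^sub>L hilb) \<Rightarrow> complex" where
  "op_trace t = (\<Sum>\<^sub>\<infinity>s. cinner (blinfun_apply t (basis s)) (basis s) / complex_of_real ((norm (basis s))\<^sup>2))"

text \<open>An operator $b$ is identified with the functional $t \mapsto$ \<open>op_trace (b t)\<close> on the
  trace class operators. Under this identification the canonical image of $t$ in the second
  dual of the trace class is the functional $b \mapsto$ \<open>op_trace (b t)\<close> on $B(H)$, and an
  element \<open>\<tau>\<close> of the bidual of \<open>Alg\<close>, regarded as an element of the bidual of $B(H)$, is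
  evaluated at such a functional through its restriction to \<open>Alg\<close>. Existence and uniqueness
  of the operator is \<open>theta_exists1\<close>, and \<open>theta_cinner\<close> gives its coefficients
  $\langle \theta(\tau)\eta, \zeta\rangle$.\<close>

definition theta :: "(((hilb \<Rightarrow>\<^sub>L hilb) \<Rightarrow> complex) \<Rightarrow> complex) \<Rightarrow> (hilb \<Rightarrow>\<^sub>L hilb)" where
  "theta \<tau> = (THE b. b \<in> BH \<and>
     (\<forall>t\<in>trace_class. op_trace (b o\<^sub>L t) = \<tau> (\<lambda>a. if a \<in> Alg then op_trace (a o\<^sub>L t) else 0)))"

lemma cinner_add_right: "cinner x (y + z) = cinner x y + cinner x z"
  by (metis cinner_add_left cinner_commute complex_cnj_add)

lemma cinner_scaleC_right: "cinner x (scaleC c y) = cnj c * cinner x y"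
  by (metis cinner_scaleC_left cinner_commute complex_cnj_mult)

lemma bounded_linear_cinner_left: "bounded_linear (\<lambda>x. cinner x y)"
  by (rule bounded_linear_intro[of _ "norm y"])
    (simp_all add: cinner_add_left scaleR_scaleC cinner_scaleC_left scaleR_conv_of_real cmod_cinner_le)

lemma bounded_linear_cinner_right: "bounded_linear (cinner x)"
  by (rule bounded_linear_intro[of _ "norm x"])
    (simp_all add: cinner_add_right scaleR_scaleC cinner_scaleC_right scaleR_conv_of_real
      cmod_cinner_le mult.commute[of _ "norm x"])

lemma coef_eq_cinner: "coef x s = cinner x (basis s) / complex_of_real ((Wt s)\<^sup>2)"
  by (simp add: cinner_basis_right)

lemma bounded_linear_coef: "bounded_linear (\<lambda>x. coef x s)"
  unfolding coef_eq_cinner by (rule bounded_linear_compose[OF bounded_linear_divide bounded_linear_cinner_left])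

lemma Alg_closed:
  shows Alg_subset_BH: "Alg \<subseteq> BH"
    and Alg_zero: "0 \<in> Alg"
    and Alg_add: "a \<in> Alg \<Longrightarrow> b \<in> Alg \<Longrightarrow> a + b \<in> Alg"
    and Alg_scaleC: "a \<in> Alg \<Longrightarrow> scaleC_op c a \<in> Alg"
proof -
  have "closed BH"
  proof -
    have eq: "BH = (\<Inter>c. \<Inter>x. {T. blinfun_apply T (scaleC c x) = scaleC c (blinfun_apply T x)})"
      by (auto simp: BH_def)
    have "closed {T. blinfun_apply T (scaleC c x) = scaleC c (blinfun_apply T x)}" for c x
      by (intro closed_Collect_eq continuous_intros
          continuous_on_compose2[OF linear_continuous_on[OF bounded_linear_scaleC], of UNIV]) auto
    then show ?thesis unfolding eq by (intro closed_INT ballI)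
  qed
  moreover have "Alg0 \<subseteq> BH"
  proof
    fix T assume "T \<in> Alg0"
    then show "T \<in> BH"
    proof induction
      case (gen c)
      show ?case by (rule T_op_BH)
    next
      case (scale T c)
      then show ?case by (auto simp: BH_def intro!: hilb_eqI)
    qed (simp_all add: BH_def blinfun.add_left scaleC_add_right)
  qed
  ultimately show "Alg \<subseteq> BH" unfolding Alg_def by (simp add: closure_minimal)
  have "[Lg] \<in> colours" by (auto simp: colours_def intro!: exI[of _ 1])
  then have "scaleC_op 0 (T_op [Lg]) \<in> Alg0" by (intro Alg0.scale Alg0.gen)
  moreover have "scaleC_op 0 (T_op [Lg]) = 0" by (auto intro!: blinfun_eqI hilb_eqI)
  ultimately show "0 \<in> Alg" unfolding Alg_def using closure_subset[of Alg0] by auto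
  show "a + b \<in> Alg" if ab: "a \<in> Alg" "b \<in> Alg" for a b
  proof -
    obtain f g where "\<And>n. f n \<in> Alg0" "f \<longlonglongrightarrow> a" "\<And>n. g n \<in> Alg0" "g \<longlonglongrightarrow> b"
      using ab unfolding Alg_def closure_sequential by blast
    then show ?thesis unfolding Alg_def closure_sequential
      by (intro exI[of _ "\<lambda>n. f n + g n"]) (auto intro: Alg0.add tendsto_add)
  qed
  show "scaleC_op c a \<in> Alg" if a: "a \<in> Alg" for c a
  proof -
    obtain f where f: "\<And>n. f n \<in> Alg0" "f \<longlonglongrightarrow> a"
      using a unfolding Alg_def closure_sequential by blast
    have "(\<lambda>n. scaleC_op c (f n)) \<longlonglongrightarrow> scaleC_op c a"
      unfolding scaleC_op_def
      by (intro bounded_linear.tendsto[OF bounded_bilinear.bounded_linear_right[OF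
              bounded_bilinear_blinfun_compose]] f)
    then show ?thesis unfolding Alg_def closure_sequential
      using f by (intro exI[of _ "\<lambda>n. scaleC_op c (f n)"]) (auto intro: Alg0.scale)
  qed
qed

text \<open>The functional $a \mapsto \sum_n \langle a \eta_n, \zeta_n\rangle$ on \<open>Alg\<close>.\<close>

definition vec_fun :: "(nat \<Rightarrow> hilb) \<Rightarrow> (nat \<Rightarrow> hilb) \<Rightarrow> (hilb \<Rightarrow>\<^sub>L hilb) \<Rightarrow> complex" where
  "vec_fun \<eta> \<zeta> = (\<lambda>a. if a \<in> Alg then \<Sum>n. cinner (blinfun_apply a (\<eta> n)) (\<zeta> n) else 0)"

definition vec_fun1 :: "hilb \<Rightarrow> hilb \<Rightarrow> (hilb \<Rightarrow>\<^sub>L hilb) \<Rightarrow> complex" where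
  "vec_fun1 \<eta> \<zeta> = (\<lambda>a. if a \<in> Alg then cinner (blinfun_apply a \<eta>) \<zeta> else 0)"

lemma cmod_vec_le: "cmod (cinner (blinfun_apply a x) y) \<le> norm a * (norm x * norm y)"
  by (rule order_trans[OF cmod_cinner_le])
    (use mult_right_mono[OF norm_blinfun[of a x] norm_ge_zero[of y]] in \<open>simp add: mult.assoc\<close>)

lemma vec_summable:
  assumes "summable (\<lambda>n. norm (\<eta> n) * norm (\<zeta> n))"
  shows "summable (\<lambda>n. cmod (cinner (blinfun_apply a (\<eta> n)) (\<zeta> n)))"
    and "summable (\<lambda>n. cinner (blinfun_apply a (\<eta> n)) (\<zeta> n))"
proof -
  show *: "summable (\<lambda>n. cmod (cinner (blinfun_apply a (\<eta> n)) (\<zeta> n)))"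
    by (rule summable_comparison_test'[OF summable_mult[OF assms, of "norm a"], of 0])
      (simp add: cmod_vec_le)
  show "summable (\<lambda>n. cinner (blinfun_apply a (\<eta> n)) (\<zeta> n))"
    by (rule summable_norm_cancel[OF *])
qed

lemma vec_fun_bound:
  assumes "summable (\<lambda>n. norm (\<eta> n) * norm (\<zeta> n))"
  shows "cmod (vec_fun \<eta> \<zeta> a) \<le> (\<Sum>n. norm (\<eta> n) * norm (\<zeta> n)) * norm a"
proof (cases "a \<in> Alg")
  case True
  have "cmod (vec_fun \<eta> \<zeta> a) \<le> (\<Sum>n. cmod (cinner (blinfun_apply a (\<eta> n)) (\<zeta> n)))"
    unfolding vec_fun_def using True by (simp add: summable_norm vec_summable(1)[OF assms])
  also have "\<dots> \<le> (\<Sum>n. norm a * (norm (\<eta> n) * norm (\<zeta> n)))"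
    by (intro suminf_le cmod_vec_le vec_summable summable_mult assms)
  finally show ?thesis by (simp add: suminf_mult[OF assms] mult.commute)
qed (simp add: vec_fun_def suminf_nonneg[OF assms])

lemma vec_fun_dual:
  assumes "summable (\<lambda>n. norm (\<eta> n) * norm (\<zeta> n))"
  shows "vec_fun \<eta> \<zeta> \<in> Alg_dual"
  unfolding Alg_dual_def
proof (intro CollectI conjI ballI allI impI)
  fix a b assume "a \<in> Alg" "b \<in> Alg"
  then show "vec_fun \<eta> \<zeta> (a + b) = vec_fun \<eta> \<zeta> a + vec_fun \<eta> \<zeta> b"
    by (simp add: vec_fun_def Alg_add blinfun.add_left cinner_add_left
        suminf_add[OF vec_summable(2)[OF assms] vec_summable(2)[OF assms]])
next
  fix c a assume "a \<in> Alg"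
  then show "vec_fun \<eta> \<zeta> (scaleC_op c a) = c * vec_fun \<eta> \<zeta> a"
    by (simp add: vec_fun_def Alg_scaleC cinner_scaleC_left suminf_mult[OF vec_summable(2)[OF assms]])
next
  show "\<exists>K. \<forall>a\<in>Alg. cmod (vec_fun \<eta> \<zeta> a) \<le> K * norm a"
    using vec_fun_bound[OF assms] by blast
qed (simp add: vec_fun_def)

lemma Alg_dual_norm_le:
  assumes "\<And>a. a \<in> Alg \<Longrightarrow> cmod (f a) \<le> K * norm a" "0 \<le> K"
  shows "Alg_dual_norm f \<le> K"
  unfolding Alg_dual_norm_def
proof (rule cSUP_least)
  show "{a \<in> Alg. norm a \<le> 1} \<noteq> {}" using Alg_zero by (auto intro!: exI[of _ 0])
  fix a assume a: "a \<in> {a \<in> Alg. norm a \<le> 1}"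
  then have "cmod (f a) \<le> K * norm a" using assms by simp
  also have "\<dots> \<le> K" using a assms(2) by (simp add: mult_left_le)
  finally show "cmod (f a) \<le> K" .
qed

lemma vec_fun1_eq: "vec_fun1 \<eta> \<zeta> = vec_fun (\<lambda>n. if n = 0 then \<eta> else 0) (\<lambda>_. \<zeta>)"
proof
  fix a
  have "(\<Sum>n. cinner (blinfun_apply a (if n = 0 then \<eta> else 0)) \<zeta>) =
      (\<Sum>n\<in>{0 :: nat}. cinner (blinfun_apply a (if n = 0 then \<eta> else 0)) \<zeta>)"
    by (rule suminf_finite) (auto simp: blinfun.zero_right cinner_def)
  then show "vec_fun1 \<eta> \<zeta> a = vec_fun (\<lambda>n. if n = 0 then \<eta> else 0) (\<lambda>_. \<zeta>) a"
    by (simp add: vec_fun1_def vec_fun_def)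
qed

lemma vec_fun1_dual: "vec_fun1 \<eta> \<zeta> \<in> Alg_dual"
  unfolding vec_fun1_eq
  by (rule vec_fun_dual, rule summable_finite[of "{0}"]) auto

lemma vec_fun1_norm: "Alg_dual_norm (vec_fun1 \<eta> \<zeta>) \<le> norm \<eta> * norm \<zeta>"
proof (rule Alg_dual_norm_le)
  show "cmod (vec_fun1 \<eta> \<zeta> a) \<le> norm \<eta> * norm \<zeta> * norm a" if "a \<in> Alg" for a
    using cmod_vec_le[of a \<eta> \<zeta>] that by (simp add: vec_fun1_def mult.commute)
qed simp

lemma bidual_simps:
  assumes "\<tau> \<in> Alg_bidual" "f \<in> Alg_dual"
  shows bidual_add: "f' \<in> Alg_dual \<Longrightarrow> \<tau> (\<lambda>a. f a + f' a) = \<tau> f + \<tau> f'"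
    and bidual_scale: "\<tau> (\<lambda>a. c * f a) = c * \<tau> f"
  using assms by (auto simp: Alg_bidual_def)

lemma bidual_bound:
  assumes "\<tau> \<in> Alg_bidual"
  obtains K where "0 \<le> K"
    and "\<And>f k. f \<in> Alg_dual \<Longrightarrow> Alg_dual_norm f \<le> k \<Longrightarrow> 0 \<le> k \<Longrightarrow> cmod (\<tau> f) \<le> K * k"
proof -
  obtain K where K: "\<And>f. f \<in> Alg_dual \<Longrightarrow> cmod (\<tau> f) \<le> K * Alg_dual_norm f"
    using assms unfolding Alg_bidual_def by blast
  have nn: "0 \<le> Alg_dual_norm f" if f: "f \<in> Alg_dual" for f
  proof -
    obtain C where C: "\<And>a. a \<in> Alg \<Longrightarrow> cmod (f a) \<le> C * norm a"
      using f unfolding Alg_dual_def by blast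
    have "bdd_above ((\<lambda>a. cmod (f a)) ` {a \<in> Alg. norm a \<le> 1})"
    proof (rule bdd_aboveI2)
      fix a assume a: "a \<in> {a \<in> Alg. norm a \<le> 1}"
      have "cmod (f a) \<le> C * norm a" using a C by simp
      also have "\<dots> \<le> \<bar>C\<bar> * 1" using a by (intro mult_mono) auto
      finally show "cmod (f a) \<le> \<bar>C\<bar>" by simp
    qed
    then have "cmod (f 0) \<le> Alg_dual_norm f"
      unfolding Alg_dual_norm_def using Alg_zero by (intro cSUP_upper) auto
    then show ?thesis using norm_ge_zero order_trans by blast
  qed
  show ?thesis
  proof (rule that[of "\<bar>K\<bar>"])
    fix f k assume f: "f \<in> Alg_dual" "Alg_dual_norm f \<le> k" "0 \<le> k"
    have "cmod (\<tau> f) \<le> K * Alg_dual_norm f" by (rule K[OF f(1)])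
    also have "\<dots> \<le> \<bar>K\<bar> * k" using f nn[OF f(1)] by (intro mult_mono) auto
    finally show "cmod (\<tau> f) \<le> \<bar>K\<bar> * k" .
  qed simp
qed

lemma vec_fun_sums:
  assumes \<tau>: "\<tau> \<in> Alg_bidual" and s: "summable (\<lambda>n. norm (\<eta> n) * norm (\<zeta> n))"
  shows "(\<lambda>n. \<tau> (vec_fun1 (\<eta> n) (\<zeta> n))) sums \<tau> (vec_fun \<eta> \<zeta>)"
proof -
  obtain K where K: "0 \<le> K"
    "\<And>f k. f \<in> Alg_dual \<Longrightarrow> Alg_dual_norm f \<le> k \<Longrightarrow> 0 \<le> k \<Longrightarrow> cmod (\<tau> f) \<le> K * k"
    using bidual_bound[OF \<tau>] by metis
  let ?R = "\<lambda>N. vec_fun (\<lambda>n. \<eta> (n + N)) (\<lambda>n. \<zeta> (n + N))"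
  let ?r = "\<lambda>N. \<Sum>n. norm (\<eta> (n + N)) * norm (\<zeta> (n + N))"
  have sN: "summable (\<lambda>n. norm (\<eta> (n + N)) * norm (\<zeta> (n + N)))" for N
    using summable_ignore_initial_segment[OF s, of N] .
  have split: "?R N = (\<lambda>a. vec_fun1 (\<eta> N) (\<zeta> N) a + ?R (Suc N) a)" for N
  proof
    fix a
    show "?R N a = vec_fun1 (\<eta> N) (\<zeta> N) a + ?R (Suc N) a"
      using suminf_split_head[OF vec_summable(2)[OF sN[of N], of a]]
      by (simp add: vec_fun_def vec_fun1_def)
  qed
  have eq: "\<tau> (vec_fun \<eta> \<zeta>) = (\<Sum>n<N. \<tau> (vec_fun1 (\<eta> n) (\<zeta> n))) + \<tau> (?R N)" for N
  proof (induction N)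
    case (Suc N)
    have "\<tau> (?R N) = \<tau> (vec_fun1 (\<eta> N) (\<zeta> N)) + \<tau> (?R (Suc N))"
      by (subst split, rule bidual_add[OF \<tau> vec_fun1_dual vec_fun_dual[OF sN]])
    with Suc show ?case by simp
  qed simp
  have "?r \<longlonglongrightarrow> 0"
    using suminf_exist_split2[OF s] .
  then have lim: "(\<lambda>N. K * ?r N) \<longlonglongrightarrow> 0" by (rule tendsto_mult_right_zero)
  have "cmod (\<tau> (?R N)) \<le> K * ?r N" for N
    by (intro K(2) vec_fun_dual Alg_dual_norm_le vec_fun_bound suminf_nonneg sN) simp_all
  then have "(\<lambda>N. \<tau> (?R N)) \<longlonglongrightarrow> 0"
    by (intro Lim_null_comparison[OF _ lim] always_eventually allI)
  then have "(\<lambda>N. \<tau> (vec_fun \<eta> \<zeta>) - \<tau> (?R N)) \<longlonglongrightarrow> \<tau> (vec_fun \<eta> \<zeta>) - 0"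
    by (intro tendsto_intros)
  moreover have "(\<Sum>n<N. \<tau> (vec_fun1 (\<eta> n) (\<zeta> n))) = \<tau> (vec_fun \<eta> \<zeta>) - \<tau> (?R N)" for N
    using eq[of N] by (simp only: add_diff_cancel_right')
  ultimately show ?thesis unfolding sums_def by simp
qed

lemma op_trace_coef: "op_trace t = (\<Sum>\<^sub>\<infinity>s. coef (blinfun_apply t (basis s)) s)"
  unfolding op_trace_def norm_basis coef_eq_cinner ..

lemma cinner_abs_bound:
  "(\<Sum>\<^sub>\<infinity>s. cmod (complex_of_real ((Wt s)\<^sup>2) * coef x s * cnj (coef y s))) \<le> norm x * norm y"
proof -
  have ex: "\<exists>x'. (\<forall>s. coef x' s = complex_of_real (cmod (coef x s))) \<and> norm x' = norm x" for x
  proof -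
    have c: "coef (Abs_hilb (\<lambda>s. complex_of_real (cmod (coef x s)))) s
        = complex_of_real (cmod (coef x s))" for s
      using coef_summable[of x] by (subst Abs_hilb_inverse) simp_all
    then show ?thesis
      by (intro exI[of _ "Abs_hilb (\<lambda>s. complex_of_real (cmod (coef x s)))"])
        (simp add: norm_hilb_def)
  qed
  obtain x' y' where x': "\<And>s. coef x' s = complex_of_real (cmod (coef x s))" "norm x' = norm x"
    and y': "\<And>s. coef y' s = complex_of_real (cmod (coef y s))" "norm y' = norm y"
    using ex[of x] ex[of y] by blast
  have "((\<lambda>s. complex_of_real (cmod (complex_of_real ((Wt s)\<^sup>2) * coef x s * cnj (coef y s)))) has_sum
      complex_of_real (\<Sum>\<^sub>\<infinity>s. cmod (complex_of_real ((Wt s)\<^sup>2) * coef x s * cnj (coef y s)))) UNIV"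
    by (intro has_sum_of_real has_sum_infsum summable_prod_aux)
  then have "cinner x' y' =
      complex_of_real (\<Sum>\<^sub>\<infinity>s. cmod (complex_of_real ((Wt s)\<^sup>2) * coef x s * cnj (coef y s)))"
    unfolding cinner_def x' y' by (intro infsumI) (simp add: norm_mult norm_power)
  moreover have "Re (cinner x' y') \<le> norm x * norm y"
    using complex_Re_le_cmod[of "cinner x' y'"] cmod_cinner_le[of x' y'] x' y' by simp
  ultimately show ?thesis by simp
qed

lemma op_trace_nuclear:
  assumes s: "summable (\<lambda>n. norm (\<eta> n) * norm (\<zeta> n))"
    and t: "\<And>x. (\<lambda>n. scaleC (cinner x (\<zeta> n)) (\<eta> n)) sums blinfun_apply t x"
    and b: "b \<in> BH"
  shows "op_trace (b o\<^sub>L t) = (\<Sum>n. cinner (blinfun_apply b (\<eta> n)) (\<zeta> n))"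
proof -
  define g where "g n s = complex_of_real ((Wt s)\<^sup>2) * coef (blinfun_apply b (\<eta> n)) s * cnj (coef (\<zeta> n) s)"
    for n s
  have gsum: "(\<lambda>s. cmod (g n s)) summable_on UNIV" for n
    unfolding g_def by (rule summable_prod_aux)
  have gle: "(\<Sum>\<^sub>\<infinity>s. cmod (g n s)) \<le> norm b * (norm (\<eta> n) * norm (\<zeta> n))" for n
  proof -
    have "(\<Sum>\<^sub>\<infinity>s. cmod (g n s)) \<le> norm (blinfun_apply b (\<eta> n)) * norm (\<zeta> n)"
      unfolding g_def by (rule cinner_abs_bound)
    also have "\<dots> \<le> norm b * norm (\<eta> n) * norm (\<zeta> n)"
      by (intro mult_right_mono norm_blinfun) simp
    finally show ?thesis by (simp add: mult.assoc)
  qed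
  have bs: "(\<lambda>n. norm b * (norm (\<eta> n) * norm (\<zeta> n))) summable_on (UNIV :: nat set)"
    using summable_mult[OF s, of "norm b"]
    by (intro norm_summable_imp_summable_on) (simp add: abs_mult)
  have "(\<lambda>n. norm (\<Sum>\<^sub>\<infinity>s. cmod (g n s))) summable_on (UNIV :: nat set)"
    by (rule Infinite_Sum.abs_summable_on_comparison_test'[OF bs]) (simp add: infsum_nonneg gle)
  then have "(\<lambda>p. norm (g (fst p) (snd p))) summable_on (UNIV \<times> UNIV)"
    by (subst Infinite_Sum.abs_summable_on_Sigma_iff) (simp add: gsum)
  then have prod: "(\<lambda>(n, s). g n s) summable_on (UNIV \<times> UNIV)"
    unfolding case_prod_beta' by (rule abs_summable_summable)
  have coefs: "coef (blinfun_apply (b o\<^sub>L t) (basis s)) s = (\<Sum>\<^sub>\<infinity>n. g n s)" for s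
  proof -
    have "(\<lambda>n. coef (blinfun_apply b (scaleC (cinner (basis s) (\<zeta> n)) (\<eta> n))) s)
        sums coef (blinfun_apply b (blinfun_apply t (basis s))) s"
      by (intro bounded_linear.sums[OF bounded_linear_coef]
          bounded_linear.sums[OF blinfun.bounded_linear_right] t)
    moreover have "coef (blinfun_apply b (scaleC (cinner (basis s) (\<zeta> n)) (\<eta> n))) s = g n s" for n
      using cinner_basis_right[of "\<zeta> n" s] cinner_commute[of "basis s" "\<zeta> n"]
      by (simp add: BH_scaleC[OF b] g_def)
    ultimately have 1: "(\<lambda>n. g n s) sums coef (blinfun_apply (b o\<^sub>L t) (basis s)) s" by simp
    have "cmod (g n s) \<le> norm b * (norm (\<eta> n) * norm (\<zeta> n))" for n
      using finite_sum_le_infsum[OF gsum[of n], of "{s}"] gle[of n] by simp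
    then have "(\<lambda>n. g n s) summable_on UNIV"
      by (rule abs_summable_summable[OF Infinite_Sum.abs_summable_on_comparison_test'[OF bs]])
    then have "(\<lambda>n. g n s) sums (\<Sum>\<^sub>\<infinity>n. g n s)"
      by (intro has_sum_imp_sums has_sum_infsum)
    with 1 show ?thesis by (rule sums_unique2)
  qed
  have "op_trace (b o\<^sub>L t) = (\<Sum>\<^sub>\<infinity>s. \<Sum>\<^sub>\<infinity>n. g n s)"
    unfolding op_trace_coef by (simp only: coefs)
  also have "\<dots> = (\<Sum>\<^sub>\<infinity>n. \<Sum>\<^sub>\<infinity>s. g n s)"
    by (rule infsum_swap_banach[symmetric, OF prod])
  also have "\<dots> = (\<Sum>\<^sub>\<infinity>n. cinner (blinfun_apply b (\<eta> n)) (\<zeta> n))"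
    unfolding g_def cinner_def ..
  also have "\<dots> = (\<Sum>n. cinner (blinfun_apply b (\<eta> n)) (\<zeta> n))"
    by (intro infsumI norm_summable_imp_has_sum vec_summable s summable_sums)
  finally show ?thesis .
qed

lemma rank_one:
  obtains t where "t \<in> trace_class" "\<And>b. b \<in> BH \<Longrightarrow> op_trace (b o\<^sub>L t) = cinner (blinfun_apply b \<eta>) \<zeta>"
proof -
  define t where "t = Blinfun (\<lambda>x. scaleC (cinner x \<zeta>) \<eta>)"
  have bl: "bounded_linear (\<lambda>x. scaleC (cinner x \<zeta>) \<eta>)"
  proof (rule bounded_linear_intro[of _ "norm \<zeta> * norm \<eta>"])
    show "norm (scaleC (cinner x \<zeta>) \<eta>) \<le> norm x * (norm \<zeta> * norm \<eta>)" for x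
      using mult_right_mono[OF cmod_cinner_le[of x \<zeta>] norm_ge_zero[of \<eta>]]
      by (simp add: norm_scaleC mult.assoc)
  qed (auto intro!: hilb_eqI simp: cinner_add_left scaleR_scaleC cinner_scaleC_left algebra_simps)
  have app: "blinfun_apply t x = scaleC (cinner x \<zeta>) \<eta>" for x
    unfolding t_def by (simp add: bounded_linear_Blinfun_apply[OF bl])
  let ?e = "\<lambda>n :: nat. if n = 0 then \<eta> else 0"
  have s: "summable (\<lambda>n. norm (?e n) * norm \<zeta>)"
    by (rule summable_finite[of "{0}"]) auto
  have t: "(\<lambda>n. scaleC (cinner x \<zeta>) (?e n)) sums blinfun_apply t x" for x
  proof -
    have "(\<lambda>n. scaleC (cinner x \<zeta>) (?e n)) = (\<lambda>n. if n = 0 then scaleC (cinner x \<zeta>) \<eta> else 0)"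
      by (auto intro!: hilb_eqI)
    then show ?thesis using sums_single[of 0 "\<lambda>_. scaleC (cinner x \<zeta>) \<eta>"] by (simp add: app)
  qed
  show ?thesis
  proof
    have "t \<in> BH" by (auto simp: BH_def app cinner_scaleC_left intro!: hilb_eqI)
    then show "t \<in> trace_class"
      unfolding trace_class_def using s t by (intro CollectI conjI exI[of _ ?e] exI[of _ "\<lambda>_. \<zeta>"]) auto
    fix b assume "b \<in> BH"
    from op_trace_nuclear[OF s t this]
    have "op_trace (b o\<^sub>L t) = (\<Sum>n. cinner (blinfun_apply b (?e n)) \<zeta>)" .
    also have "\<dots> = (\<Sum>n\<in>{0}. cinner (blinfun_apply b (?e n)) \<zeta>)"
      by (rule suminf_finite) (auto simp: blinfun.zero_right cinner_def)
    finally show "op_trace (b o\<^sub>L t) = cinner (blinfun_apply b \<eta>) \<zeta>" by simp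
  qed
qed

lemma bidual_operator:
  assumes \<tau>: "\<tau> \<in> Alg_bidual"
  obtains b where "b \<in> BH" "\<And>\<eta> \<zeta>. cinner (blinfun_apply b \<eta>) \<zeta> = \<tau> (vec_fun1 \<eta> \<zeta>)"
proof -
  obtain K where K: "0 \<le> K"
    "\<And>f k. f \<in> Alg_dual \<Longrightarrow> Alg_dual_norm f \<le> k \<Longrightarrow> 0 \<le> k \<Longrightarrow> cmod (\<tau> f) \<le> K * k"
    using bidual_bound[OF \<tau>] by metis
  define B where "B \<eta> \<zeta> = \<tau> (vec_fun1 \<eta> \<zeta>)" for \<eta> \<zeta>
  have Bb: "cmod (B \<eta> \<zeta>) \<le> K * (norm \<eta> * norm \<zeta>)" for \<eta> \<zeta>
    unfolding B_def by (intro K vec_fun1_dual vec_fun1_norm) simp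
  have Bal: "B (x + y) z = B x z + B y z" for x y z
  proof -
    have "vec_fun1 (x + y) z = (\<lambda>a. vec_fun1 x z a + vec_fun1 y z a)"
      by (auto simp: vec_fun1_def blinfun.add_right cinner_add_left)
    then show ?thesis unfolding B_def using bidual_add[OF \<tau> vec_fun1_dual vec_fun1_dual] by simp
  qed
  have Bar: "B x (y + z) = B x y + B x z" for x y z
  proof -
    have "vec_fun1 x (y + z) = (\<lambda>a. vec_fun1 x y a + vec_fun1 x z a)"
      by (auto simp: vec_fun1_def cinner_add_right)
    then show ?thesis unfolding B_def using bidual_add[OF \<tau> vec_fun1_dual vec_fun1_dual] by simp
  qed
  have Bsl: "B (scaleC c x) y = c * B x y" for c x y
  proof -
    have "vec_fun1 (scaleC c x) y = (\<lambda>a. c * vec_fun1 x y a)"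
      using Alg_subset_BH by (auto simp: vec_fun1_def BH_scaleC subset_eq cinner_scaleC_left)
    then show ?thesis unfolding B_def using bidual_scale[OF \<tau> vec_fun1_dual] by simp
  qed
  have Bsr: "B x (scaleC c y) = cnj c * B x y" for c x y
  proof -
    have "vec_fun1 x (scaleC c y) = (\<lambda>a. cnj c * vec_fun1 x y a)"
      by (auto simp: vec_fun1_def cinner_scaleC_right)
    then show ?thesis unfolding B_def using bidual_scale[OF \<tau> vec_fun1_dual] by simp
  qed
  have BlR: "bounded_linear (B x)" for x
  proof (rule bounded_linear_intro[of _ "K * norm x"])
    show "norm (B x y) \<le> norm y * (K * norm x)" for y
      using Bb[of x y] by (simp add: mult.commute mult.left_commute)
  qed (simp_all add: Bar scaleR_scaleC Bsr scaleR_conv_of_real)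
  define u where "u \<eta> s = B \<eta> (basis s) / complex_of_real ((Wt s)\<^sup>2)" for \<eta> s
  have fin: "(\<Sum>s\<in>F. (Wt s)\<^sup>2 * (cmod (u \<eta> s))\<^sup>2) \<le> (K * norm \<eta>)\<^sup>2" if F: "finite F" for F \<eta>
  proof -
    let ?N = "\<Sum>s\<in>F. (Wt s)\<^sup>2 * (cmod (u \<eta> s))\<^sup>2"
    let ?z = "\<Sum>s\<in>F. scaleC (u \<eta> s) (basis s)"
    have N0: "0 \<le> ?N" by (intro sum_nonneg) simp
    have c: "coef ?z s = (if s \<in> F then u \<eta> s else 0)" for s
      using F by (simp add: if_distrib[of "\<lambda>u. _ * u"] sum.delta' cong: if_cong)
    have "(norm ?z)\<^sup>2 = (\<Sum>\<^sub>\<infinity>s\<in>F. (Wt s)\<^sup>2 * (cmod (u \<eta> s))\<^sup>2)"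
      unfolding norm_sq c by (rule infsum_cong_neutral) auto
    then have nz: "(norm ?z)\<^sup>2 = ?N" using F by simp
    have "B \<eta> ?z = (\<Sum>s\<in>F. cnj (u \<eta> s) * B \<eta> (basis s))"
      by (simp add: linear_sum[OF bounded_linear.linear[OF BlR]] Bsr)
    also have "\<dots> = (\<Sum>s\<in>F. complex_of_real ((Wt s)\<^sup>2 * (cmod (u \<eta> s))\<^sup>2))"
    proof (rule sum.cong)
      fix s
      have "B \<eta> (basis s) = complex_of_real ((Wt s)\<^sup>2) * u \<eta> s" by (simp add: u_def)
      then show "cnj (u \<eta> s) * B \<eta> (basis s) = complex_of_real ((Wt s)\<^sup>2 * (cmod (u \<eta> s))\<^sup>2)"
        by (simp only: of_real_mult complex_norm_square mult.left_commute mult.commute)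
    qed simp
    finally have "B \<eta> ?z = complex_of_real ?N" by simp
    then have "cmod (B \<eta> ?z) = ?N" using N0 by (simp only: norm_of_real abs_of_nonneg)
    then have "?N \<le> K * norm \<eta> * norm ?z" using Bb[of \<eta> ?z] by (simp only: mult.assoc)
    then have "(norm ?z) * (norm ?z) \<le> K * norm \<eta> * norm ?z" using nz by (simp add: power2_eq_square)
    then have "norm ?z \<le> K * norm \<eta>"
      using K(1) by (cases "norm ?z = 0") (simp_all only: mult_le_cancel_right, auto)
    then have "(norm ?z)\<^sup>2 \<le> (K * norm \<eta>)\<^sup>2" by (intro power_mono) auto
    then show ?thesis by (simp add: nz)
  qed
  have us: "(\<lambda>s. (Wt s)\<^sup>2 * (cmod (u \<eta> s))\<^sup>2) summable_on UNIV" for \<eta>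
    using fin[of _ \<eta>] by (intro nonneg_bdd_above_summable_on bdd_aboveI2) auto
  define v where "v \<eta> = Abs_hilb (u \<eta>)" for \<eta>
  have cv: "coef (v \<eta>) s = u \<eta> s" for \<eta> s
    unfolding v_def using us[of \<eta>] by (simp add: Abs_hilb_inverse)
  have vb: "norm (v \<eta>) \<le> K * norm \<eta>" for \<eta>
  proof -
    have "(norm (v \<eta>))\<^sup>2 \<le> (K * norm \<eta>)\<^sup>2"
      unfolding norm_sq[of "v \<eta>"]
      by (rule infsum_le_finite_sums[OF coef_summable]) (simp only: cv fin)
    then show ?thesis by (rule power2_le_imp_le) (simp add: K)
  qed
  have blv: "bounded_linear v"
    by (rule bounded_linear_intro[of _ K])
      (auto intro!: hilb_eqI simp: cv u_def Bal scaleR_scaleC Bsl add_divide_distrib vb mult.commute[of _ K])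
  have app: "blinfun_apply (Blinfun v) = v" by (rule bounded_linear_Blinfun_apply[OF blv])
  show ?thesis
  proof
    show "Blinfun v \<in> BH"
      by (auto simp: BH_def app cv u_def Bsl intro!: hilb_eqI)
    fix \<eta> \<zeta>
    show "cinner (blinfun_apply (Blinfun v) \<eta>) \<zeta> = \<tau> (vec_fun1 \<eta> \<zeta>)"
      unfolding app B_def[symmetric]
      by (rule bounded_linear_ext[OF bounded_linear_cinner_right BlR])
        (simp add: cinner_scaleC_right Bsr cinner_basis_right cv u_def)
  qed
qed

lemma theta_exists1:
  assumes \<tau>: "\<tau> \<in> Alg_bidual"
  shows "\<exists>!b. b \<in> BH \<and>
    (\<forall>t\<in>trace_class. op_trace (b o\<^sub>L t) = \<tau> (\<lambda>a. if a \<in> Alg then op_trace (a o\<^sub>L t) else 0))"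
    (is "\<exists>!b. ?P b")
proof (rule ex_ex1I)
  obtain b where b: "b \<in> BH" "\<And>\<eta> \<zeta>. cinner (blinfun_apply b \<eta>) \<zeta> = \<tau> (vec_fun1 \<eta> \<zeta>)"
    using bidual_operator[OF \<tau>] by metis
  have "op_trace (b o\<^sub>L t) = \<tau> (\<lambda>a. if a \<in> Alg then op_trace (a o\<^sub>L t) else 0)"
    if tc: "t \<in> trace_class" for t
  proof -
    obtain \<eta> \<zeta> :: "nat \<Rightarrow> hilb" where s: "summable (\<lambda>n. norm (\<eta> n) * norm (\<zeta> n))"
      and t: "\<And>x. (\<lambda>n. scaleC (cinner x (\<zeta> n)) (\<eta> n)) sums blinfun_apply t x"
      using tc unfolding trace_class_def by blast
    have "(\<lambda>a. if a \<in> Alg then op_trace (a o\<^sub>L t) else 0) = vec_fun \<eta> \<zeta>"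
      using op_trace_nuclear[OF s t] Alg_subset_BH by (auto simp: vec_fun_def subset_eq)
    then show ?thesis
      using op_trace_nuclear[OF s t b(1)] sums_unique[OF vec_fun_sums[OF \<tau> s]] by (simp add: b(2))
  qed
  with b(1) show "\<exists>b. ?P b" by blast
next
  fix b b' assume P: "?P b" "?P b'"
  have "cinner (blinfun_apply b \<eta>) \<zeta> = cinner (blinfun_apply b' \<eta>) \<zeta>" for \<eta> \<zeta>
  proof -
    obtain t where t: "t \<in> trace_class"
      "\<And>b. b \<in> BH \<Longrightarrow> op_trace (b o\<^sub>L t) = cinner (blinfun_apply b \<eta>) \<zeta>"
      using rank_one[of \<eta> \<zeta>] by metis
    from P t(1) have "op_trace (b o\<^sub>L t) = op_trace (b' o\<^sub>L t)" by simp
    then show ?thesis using P t(2) by simp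
  qed
  then show "b = b'" by (intro blinfun_eqI hilb_eqI) (simp add: coef_eq_cinner)
qed

lemma theta_BH: "\<tau> \<in> Alg_bidual \<Longrightarrow> theta \<tau> \<in> BH"
  using theI'[OF theta_exists1] unfolding theta_def by blast

lemma theta_cinner:
  assumes \<tau>: "\<tau> \<in> Alg_bidual"
  shows "cinner (blinfun_apply (theta \<tau>) \<eta>) \<zeta> =
    \<tau> (\<lambda>a. if a \<in> Alg then cinner (blinfun_apply a \<eta>) \<zeta> else 0)"
proof -
  obtain t where t: "t \<in> trace_class"
    "\<And>b. b \<in> BH \<Longrightarrow> op_trace (b o\<^sub>L t) = cinner (blinfun_apply b \<eta>) \<zeta>"
    using rank_one[of \<eta> \<zeta>] by metis
  have "op_trace (theta \<tau> o\<^sub>L t) = \<tau> (\<lambda>a. if a \<in> Alg then op_trace (a o\<^sub>L t) else 0)"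
    using theI'[OF theta_exists1[OF \<tau>]] t(1) unfolding theta_def[symmetric] by blast
  moreover have "(\<lambda>a. if a \<in> Alg then op_trace (a o\<^sub>L t) else 0) =
      (\<lambda>a. if a \<in> Alg then cinner (blinfun_apply a \<eta>) \<zeta> else 0)"
    using t(2) Alg_subset_BH by (auto simp: subset_eq)
  ultimately show ?thesis using t(2)[OF theta_BH[OF \<tau>]] by simp
qed

end

theory Submission
  imports Defs
begin

text \<open>
  A pair $(k, t)$ stands for the step that leads from \<^term>\<open>drop k t\<close> to $t$ by adding $k$
  letters, and it reads a sequence of $k$ colours. A product of generators maps a basis
  word $s$ to $t$ if the step from $s$ to $t$ reads the right sequence of colours, and to $0$ if
  there is no such $t$. Hence an operator in the algebra has equal coefficients at all steps that
  read the same sequence.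

  Call a step primary if one of the words that it passes, its end included and its start
  excluded, is its own colour. Among the steps
  that read a given sequence exactly one is primary (\<open>primary_reduction\<close>,
  \<open>primary_unique\<close>). The others are copies of it: they add the letter $g$ only, and
  each of their $k$ letters carries at most half the weight of the letter that it copies. The
  copies with $k$ letters therefore form a weighted shift whose norm is at most $2^{-k}$ times
  the largest normalised coefficient at a primary step, and together they contribute at most that
  coefficient to the norm. So the norm of an operator in the algebra is equivalent to the norm of
  the matrix of its coefficients at primary steps (\<open>norm_comb_equivalent\<close>).

  For a polynomial in the generators this matrix is finite. Up to an equivalent
  norm the algebra is thus a space of compact operators, and every restriction of one of its
  finite matrices to a rectangular block is again such a matrix. A bounded functional on it is a
  norm limit of functionals that see only a finite block, by the argument which shows that the
  dual of the compact operators is the trace class (\<open>functional_concentrates\<close>).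
  Such functionals are combinations of the functionals
  $a \mapsto \langle a \eta, \zeta\rangle$, which therefore span a norm dense subspace of the
  dual of the algebra (\<open>entries_dense\<close>). The operator \<^term>\<open>theta \<tau>\<close> determines
  \<^term>\<open>\<tau>\<close> on these functionals, hence everywhere.
\<close>

section \<open>Colour paths\<close>

definition colour_path :: "nat \<Rightarrow> word \<Rightarrow> word list" where
  "colour_path k t = map (\<lambda>i. colour (drop i t)) [0..<k]"

definition primary :: "(nat \<times> word) set" where
  "primary = {(k, t). k \<le> length t \<and> (\<exists>i<k. drop i t \<in> colours)}"

definition source :: "nat \<times> word \<Rightarrow> word" where
  "source p = drop (fst p) (snd p)"

lemma length_colour_path [simp]: "length (colour_path k t) = k"
  by (simp add: colour_path_def)

lemma colour_path_eq_iff: "colour_path k t = colour_path k u \<longleftrightarrow> (\<forall>i<k. colour (drop i t) = colour (drop i u))"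
  by (auto simp: colour_path_def)

lemma colour_path_Suc: "colour_path (Suc k) t = colour t # colour_path k (tl t)"
  by (simp add: colour_path_def upt_conv_Cons map_Suc_upt[symmetric] drop_Suc del: upt_Suc)

lemma depth_filter: "depth s = length (filter (\<lambda>a. a = Lh) s)"
  by (simp add: depth_def length_filter_conv_card)

lemma depth_append: "depth (s @ t) = depth s + depth t"
  by (simp add: depth_filter)

lemma depth_simps [simp]: "depth (replicate k Lg) = 0" "depth (Lh # s) = Suc (depth s)"
  by (simp_all add: depth_filter)

lemma depth_drop_le: "depth (drop i s) \<le> depth s"
  using depth_append[of "take i s" "drop i s"] by simp

lemma Wt_drop: "k \<le> length t \<Longrightarrow> Wt t = (\<Prod>i<k. wt (drop i t)) * Wt (drop k t)"
proof (induction k)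
  case (Suc k)
  then have "drop k t = t ! k # drop (Suc k) t" by (simp add: Cons_nth_drop_Suc)
  then have "Wt (drop k t) = wt (drop k t) * Wt (drop (Suc k) t)" by (metis Wt_Cons)
  with Suc show ?case by simp
qed simp

text \<open>A step that is not primary starts at some $g^j h y$ and adds only letters $g$, because every
  word that begins with $h$ is its own colour. It cannot reach a multiple of $l(y) + 1$ letters
  $g$ either, so it stays in one period of the sequence $g h y, g^2 h y, \dots$, and there the
  colours repeat those of consecutive suffixes of $y$. A suffix of $y$ has smaller depth
  than $g^i h y$, which halves every weight.\<close>

lemma reduction_step:
  assumes "1 \<le> k" "k \<le> length t" "(k, t) \<notin> primary"
  obtains u where "k \<le> length u" "length u < length t" "colour_path k t = colour_path k u"
    "take k t = replicate k Lg" "\<And>i. i < k \<Longrightarrow> wt (drop i t) \<le> wt (drop i u) / 2"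
proof -
  have nc: "drop i t \<notin> colours" if "i < k" for i
    using assms that by (auto simp: primary_def)
  from nc[of 0] assms have "t \<noteq> []" "t \<notin> colours" by auto
  then obtain m y where t: "t = replicate m Lg @ Lh # y"
    using not_colour_cases by blast
  define n where "n = length y"
  have dr: "drop i t = replicate (m - i) Lg @ Lh # y" if "i \<le> m" for i
    using that by (simp add: t)
  have "k \<le> m"
  proof (rule ccontr)
    assume "\<not> k \<le> m"
    then have "Lh # y \<notin> colours" using nc[of m] dr[of m] by simp
    then show False using colour_in_colours[of "Lh # y"] by (simp add: colour_h)
  qed
  have nd: "\<not> (n + 1) dvd (m - i)" if "i < k" for i
    using nc[OF that] dr[of i] that \<open>k \<le> m\<close> by (auto simp: colours_def n_def)
  \<comment> \<open>The period that contains $g^m h y$ begins with $g^{m - r} h y$. That word is its own colour,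
    so the step starts there or later.\<close>
  define r where "r = m mod (n + 1)"
  have r: "r \<le> n" "r \<le> m" unfolding r_def using mod_less_divisor[of "n + 1" m]
    mod_less_eq_dividend[of m "n + 1"] by linarith+
  have "k \<le> r"
  proof (rule ccontr)
    assume "\<not> k \<le> r"
    then have "\<not> (n + 1) dvd (m - r)" using nd[of r] by simp
    then show False unfolding r_def by (metis dvd_minus_mod)
  qed
  define u where "u = drop (n - r) y"
  show ?thesis
  proof
    show "k \<le> length u" "length u < length t"
      using r \<open>k \<le> r\<close> by (simp_all add: u_def t n_def)
    show "take k t = replicate k Lg" using \<open>k \<le> m\<close> by (simp add: t)
    show "colour_path k t = colour_path k u"
      unfolding colour_path_eq_iff
    proof (intro allI impI)
      fix i assume i: "i < k"
      have "m = (m div (n + 1)) * (n + 1) + r" unfolding r_def by (simp only: div_mult_mod_eq)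
      then have "m - i = (m div (n + 1)) * (n + 1) + (r - i)" using i \<open>k \<le> r\<close> by linarith
      then have "(m - i) mod (n + 1) = (r - i) mod (n + 1)" by (metis mod_mult_self3)
      then have "colour (drop i t) = colour ((tl ^^ (n - (r - i))) y)"
        using i \<open>k \<le> r\<close> \<open>k \<le> m\<close> r
        by (intro colour_rec[OF dr[of i] n_def[symmetric] nd[OF i]]) auto
      also have "n - (r - i) = i + (n - r)" using i \<open>k \<le> r\<close> r by linarith
      finally show "colour (drop i t) = colour (drop i u)" by (simp add: tl_funpow u_def)
    qed
    fix i assume i: "i < k"
    have "depth (drop i t) = Suc (depth y)"
      using i \<open>k \<le> m\<close> by (simp add: dr depth_append)
    moreover have "depth (drop i u) \<le> depth y"
      unfolding u_def by (metis depth_drop_le le_trans)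
    ultimately show "wt (drop i t) \<le> wt (drop i u) / 2"
      unfolding wt_def by (simp add: power_decreasing)
  qed
qed

text \<open>A copied step is shorter in total length, so copying back ends at a primary step. Only the
  first reduction is used for the factor $2^{-k}$; the later ones cannot lose weight.\<close>

lemma primary_reduction:
  assumes "1 \<le> k" "k \<le> length t" "(k, t) \<notin> primary"
  obtains u where "(k, u) \<in> primary" "colour_path k t = colour_path k u" "take k t = replicate k Lg"
    "Wt t / Wt (drop k t) \<le> (1 / 2) ^ k * (Wt u / Wt (drop k u))"
proof -
  have "\<exists>u. (k, u) \<in> primary \<and> colour_path k t = colour_path k u \<and> take k t = replicate k Lg \<and>
      Wt t / Wt (drop k t) \<le> (1 / 2) ^ k * (Wt u / Wt (drop k u))"
    using assms
  proof (induction t rule: length_induct)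
    case (1 t)
    have ratio: "Wt u / Wt (drop k u) = (\<Prod>i<k. wt (drop i u))" if "k \<le> length u" for u
      using Wt_drop[OF that] by simp
    obtain u where u: "k \<le> length u" "length u < length t" "colour_path k t = colour_path k u"
      "take k t = replicate k Lg" "\<And>i. i < k \<Longrightarrow> wt (drop i t) \<le> wt (drop i u) / 2"
      using reduction_step[OF 1(2-4)] by blast
    have "(\<Prod>i<k. wt (drop i t)) \<le> (\<Prod>i<k. 1 / 2 * wt (drop i u))"
      using u(5) by (intro prod_mono) (simp add: wt_pos less_imp_le)
    then have le: "Wt t / Wt (drop k t) \<le> (1 / 2) ^ k * (Wt u / Wt (drop k u))"
      unfolding prod.distrib using u(1) 1 by (simp add: ratio)
    show ?case
    proof (cases "(k, u) \<in> primary")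
      case True
      with u le show ?thesis by blast
    next
      case False
      then obtain v where v: "(k, v) \<in> primary" "colour_path k u = colour_path k v"
        "Wt u / Wt (drop k u) \<le> (1 / 2) ^ k * (Wt v / Wt (drop k v))"
        using 1 u by blast
      have "(1 / 2) ^ k * (Wt u / Wt (drop k u)) \<le> 1 * (Wt u / Wt (drop k u))"
        by (intro mult_right_mono) (simp_all add: power_le_one)
      with v u le show ?thesis by (intro exI[of _ v]) auto
    qed
  qed
  with that show ?thesis by blast
qed

lemma length_colour_less:
  assumes "s \<noteq> []" "s \<notin> colours"
  shows "length (colour s) < length s"
proof -
  have "1 \<le> length s" using assms(1) by (cases s) auto
  moreover have "(1, s) \<notin> primary" using assms by (simp add: primary_def)
  ultimately obtain u where u: "1 \<le> length u" "length u < length s" "colour_path 1 s = colour_path 1 u"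
    using reduction_step[of 1 s] by auto
  then have "colour s = colour u" by (simp add: colour_path_eq_iff)
  moreover have "length (colour u) \<le> length u" using colour_in_colours[of u] u(1) by force
  ultimately show ?thesis using u(2) by simp
qed

text \<open>The colour of a word is at most as long as the word, with equality only for words that are
  their own colour. If a word on the one path is its own colour, the word at the same place of the
  other path is therefore at least as long. By symmetry the two words have equal length, and so
  they coincide. From there the colours determine the added letters, since the two
  extensions of a word by one letter have different colours.\<close>

lemma primary_unique:
  assumes "(k, t) \<in> primary" "(k, u) \<in> primary" "colour_path k t = colour_path k u"
  shows "t = u"
proof -
  have le: "length t \<le> length u" if pr: "(k, t) \<in> primary" "(k, u) \<in> primary"
    "colour_path k t = colour_path k u" for t u
  proof -
    obtain i where i: "i < k" "drop i t \<in> colours" using pr by (auto simp: primary_def)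
    have "k \<le> length t" "k \<le> length u" using pr by (auto simp: primary_def)
    have "colour (drop i u) = drop i t" using pr(3) i by (metis colour_path_eq_iff colour_colour)
    moreover have "drop i u \<noteq> []" using i \<open>k \<le> length u\<close> by simp
    ultimately have "length (drop i t) \<le> length (drop i u)" using colour_in_colours by metis
    then show ?thesis using i \<open>k \<le> length t\<close> \<open>k \<le> length u\<close> by simp
  qed
  have len: "length t = length u" using le[of t u] le[of u t] assms by simp
  obtain i where i: "i < k" "drop i t \<in> colours" using assms by (auto simp: primary_def)
  have k: "k \<le> length u" using assms by (auto simp: primary_def)
  have col: "colour (drop i u) = drop i t" using assms(3) i by (metis colour_path_eq_iff colour_colour)
  have "drop i u \<in> colours"
    using length_colour_less[of "drop i u"] col i k len by auto
  then have base: "drop i t = drop i u" using col by (simp add: colour_colour)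
  have "drop (i - j) t = drop (i - j) u" for j
  proof (induction j)
    case (Suc j)
    show ?case
    proof (cases "i - j = 0")
      case False
      define m where "m = i - Suc j"
      have m: "i - j = Suc m" "m < k" "m < length t" "m < length u"
        using False i k len by (auto simp: m_def)
      then have eq: "drop m t = t ! m # drop (Suc m) u" "drop m u = u ! m # drop (Suc m) u"
        using Suc by (metis Cons_nth_drop_Suc)+
      moreover have "colour (drop m t) = colour (drop m u)"
        using assms(3) m by (simp add: colour_path_eq_iff)
      ultimately have "t ! m = u ! m"
        using colour_ne[of "drop (Suc m) u"] by (cases "t ! m"; cases "u ! m") auto
      then show ?thesis using eq by (simp add: m_def)
    next
      case True
      then show ?thesis using Suc by simp
    qed
  qed (simp add: base)
  from this[of i] show ?thesis by simp
qed

section \<open>Products of the generators\<close>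

fun T_path :: "word list \<Rightarrow> hilb \<Rightarrow>\<^sub>L hilb" where
  "T_path [] = id_blinfun"
| "T_path (c # w) = T_op c o\<^sub>L T_path w"

lemma coef_T_op:
  "coef (blinfun_apply (T_op c) v) t = (if t \<noteq> [] \<and> colour t = c then coef v (tl t) else 0)"
proof -
  have "T_op c = Blinfun (T_fun c)"
  proof (rule BH_eqI[OF T_op_BH])
    have app: "blinfun_apply (Blinfun (T_fun c)) = T_fun c"
      by (rule bounded_linear_Blinfun_apply[OF bounded_linear_T_fun])
    then show "Blinfun (T_fun c) \<in> BH" by (auto simp: BH_def coef_T_fun intro!: hilb_eqI)
    fix s
    show "blinfun_apply (T_op c) (basis s) = blinfun_apply (Blinfun (T_fun c)) (basis s)"
    proof (rule hilb_eqI)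
      fix t
      have "coef (blinfun_apply (T_op c) (basis s)) t =
          (if t \<noteq> [] \<and> colour t = c \<and> tl t = s then 1 else 0)"
        using T_op_g[of s c] T_op_h[of s c] T_op_0[of s c] colour_ne[of s]
        by (cases t; cases "hd t"; cases "colour (Lg # s) = c"; cases "colour (Lh # s) = c") auto
      then show "coef (blinfun_apply (T_op c) (basis s)) t =
          coef (blinfun_apply (Blinfun (T_fun c)) (basis s)) t"
        by (simp add: app coef_T_fun)
    qed
  qed
  then show ?thesis
    by (simp add: bounded_linear_Blinfun_apply[OF bounded_linear_T_fun] coef_T_fun)
qed

lemma coef_T_path:
  "coef (blinfun_apply (T_path w) v) t =
    (if length w \<le> length t \<and> colour_path (length w) t = w then coef v (drop (length w) t) else 0)"
proof (induction w arbitrary: t)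
  case Nil
  show ?case by (simp add: colour_path_def)
next
  case (Cons c w)
  show ?case by (cases t) (simp_all add: coef_T_op Cons colour_path_Suc)
qed

lemma T_path_append: "T_path (w @ w') = T_path w o\<^sub>L T_path w'"
  by (induction w) (auto intro!: blinfun_eqI)

lemma T_path_Alg0: "w \<noteq> [] \<Longrightarrow> set w \<subseteq> colours \<Longrightarrow> T_path w \<in> Alg0"
proof (induction w)
  case (Cons c w)
  then show ?case
  proof (cases "w = []")
    case True
    have "T_op c o\<^sub>L id_blinfun = T_op c" by (rule blinfun_eqI) simp
    with True Cons show ?thesis by (simp add: Alg0.gen)
  qed (simp add: Alg0.gen Alg0.mult)
qed simp

definition T_pair :: "nat \<times> word \<Rightarrow> hilb \<Rightarrow>\<^sub>L hilb" where
  "T_pair p = T_path (colour_path (fst p) (snd p))"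

text \<open>The basis of words is not normalised, so this matrix unit has as its norm the quotient of
  the weights of the two words.\<close>

definition unit_pair :: "nat \<times> word \<Rightarrow> hilb \<Rightarrow>\<^sub>L hilb" where
  "unit_pair p = Blinfun (\<lambda>v. scaleC (coef v (source p)) (basis (snd p)))"

lemma coef_T_pair:
  "coef (blinfun_apply (T_pair p) v) t =
    (if fst p \<le> length t \<and> colour_path (fst p) t = colour_path (fst p) (snd p) then coef v (drop (fst p) t) else 0)"
  by (simp add: T_pair_def coef_T_path)

lemma coef_unit_pair:
  "coef (blinfun_apply (unit_pair p) v) t = (if t = snd p then coef v (source p) else 0)"
proof -
  have "bounded_linear (\<lambda>c. scaleC c (basis (snd p)))"
    by (rule bounded_linear_intro[of _ "norm (basis (snd p))"])
      (auto intro!: hilb_eqI simp: norm_scaleC scaleR_conv_of_real algebra_simps)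
  then have "bounded_linear (\<lambda>v. scaleC (coef v (source p)) (basis (snd p)))"
    by (rule bounded_linear_compose[OF _ bounded_linear_coef])
  then show ?thesis by (simp add: unit_pair_def bounded_linear_Blinfun_apply)
qed

lemma T_pair_Alg0:
  assumes "p \<in> primary"
  shows "T_pair p \<in> Alg0"
  unfolding T_pair_def
proof (rule T_path_Alg0)
  obtain k t where p: "p = (k, t)" "k \<le> length t" "0 < k" using assms by (auto simp: primary_def)
  then show "colour_path (fst p) (snd p) \<noteq> []" by (auto simp: colour_path_def)
  show "set (colour_path (fst p) (snd p)) \<subseteq> colours"
  proof
    fix c assume "c \<in> set (colour_path (fst p) (snd p))"
    then obtain i where "i < k" "c = colour (drop i t)" by (auto simp: colour_path_def p)
    then show "c \<in> colours" using colour_in_colours[of "drop i t"] p by auto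
  qed
qed

text \<open>Primary steps therefore index the nonzero products of one or more generators.\<close>

lemma T_path_cases:
  assumes "w \<noteq> []" "T_path w \<noteq> 0"
  obtains p where "p \<in> primary" "T_path w = T_pair p"
proof -
  let ?k = "length w"
  obtain t where t: "?k \<le> length t" "colour_path ?k t = w"
  proof (rule ccontr)
    assume "\<not> thesis"
    then have no: "\<not> (?k \<le> length t \<and> colour_path ?k t = w)" for t using that by blast
    have "T_path w = 0" by (intro blinfun_eqI hilb_eqI) (simp add: coef_T_path no)
    with assms show False by simp
  qed
  have "1 \<le> ?k" using assms(1) by (cases w) auto
  obtain u where "(?k, u) \<in> primary" "colour_path ?k t = colour_path ?k u"
    using primary_reduction[OF \<open>1 \<le> ?k\<close> t(1)] by metis
  then show ?thesis using t by (intro that[of "(?k, u)"]) (simp_all add: T_pair_def)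
qed

section \<open>Finite combinations\<close>

text \<open>Finite matrices supported on the primary steps. With \<^const>\<open>unit_pair\<close> the function
  \<open>comb\<close> below yields the matrix as an operator, with \<^const>\<open>T_pair\<close> the element of
  the algebra that has these coefficients at the primary steps.\<close>

definition fin_primary :: "(nat \<times> word \<Rightarrow> complex) set" where
  "fin_primary = {x. finite {p. x p \<noteq> 0} \<and> {p. x p \<noteq> 0} \<subseteq> primary}"

definition comb :: "(nat \<times> word \<Rightarrow> hilb \<Rightarrow>\<^sub>L hilb) \<Rightarrow> (nat \<times> word \<Rightarrow> complex) \<Rightarrow> hilb \<Rightarrow>\<^sub>L hilb" where
  "comb V x = (\<Sum>p | x p \<noteq> 0. scaleC_op (x p) (V p))"

lemma scaleC_op_simps [simp]:
  "scaleC_op 0 T = 0" "scaleC_op (a + b) T = scaleC_op a T + scaleC_op b T"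
  "scaleC_op a (scaleC_op b T) = scaleC_op (a * b) T"
  "scaleC_op a (S + T) = scaleC_op a S + scaleC_op a T"
  by (auto intro!: blinfun_eqI hilb_eqI simp: blinfun.add_left algebra_simps)

lemma scaleC_op_sum: "scaleC_op a (\<Sum>i\<in>I. f i) = (\<Sum>i\<in>I. scaleC_op a (f i))"
proof (induction I rule: infinite_finite_induct)
  case empty
  show ?case by (auto intro!: blinfun_eqI hilb_eqI)
next
  case (infinite A)
  then show ?case by (auto intro!: blinfun_eqI hilb_eqI)
qed simp

lemma norm_scaleC_op_le: "norm (scaleC_op c T) \<le> cmod c * norm T"
proof (rule norm_blinfun_bound)
  fix v
  show "norm (blinfun_apply (scaleC_op c T) v) \<le> cmod c * norm T * norm v"
    using mult_left_mono[OF norm_blinfun[of T v], of "cmod c"] by (simp add: norm_scaleC mult.assoc)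
qed simp

lemma fin_primaryD:
  assumes "x \<in> fin_primary"
  shows "finite {p. x p \<noteq> 0}" "x p \<noteq> 0 \<Longrightarrow> p \<in> primary"
  using assms by (auto simp: fin_primary_def)

lemma fin_primary_add: "x \<in> fin_primary \<Longrightarrow> y \<in> fin_primary \<Longrightarrow> (\<lambda>p. x p + y p) \<in> fin_primary"
proof -
  assume *: "x \<in> fin_primary" "y \<in> fin_primary"
  have "{p. x p + y p \<noteq> 0} \<subseteq> {p. x p \<noteq> 0} \<union> {p. y p \<noteq> 0}" by auto
  with * show ?thesis unfolding fin_primary_def by (auto intro: finite_subset)
qed

lemma fin_primary_restrict:
  assumes "x \<in> fin_primary" "\<And>p. x p = 0 \<Longrightarrow> y p = 0"
  shows "y \<in> fin_primary"
proof -
  have "{p. y p \<noteq> 0} \<subseteq> {p. x p \<noteq> 0}" using assms(2) by auto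
  with assms(1) show ?thesis unfolding fin_primary_def by (auto intro: finite_subset)
qed

lemma comb_eq:
  assumes "finite G" "{p. x p \<noteq> 0} \<subseteq> G"
  shows "comb V x = (\<Sum>p\<in>G. scaleC_op (x p) (V p))"
  unfolding comb_def using assms by (intro sum.mono_neutral_left) auto

lemma comb_add:
  assumes "x \<in> fin_primary" "y \<in> fin_primary"
  shows "comb V (\<lambda>p. x p + y p) = comb V x + comb V y"
proof -
  let ?G = "{p. x p \<noteq> 0} \<union> {p. y p \<noteq> 0}"
  have G: "finite ?G" using assms by (simp add: fin_primary_def)
  have "comb V (\<lambda>p. x p + y p) = (\<Sum>p\<in>?G. scaleC_op (x p + y p) (V p))"
    by (rule comb_eq[OF G]) auto
  also have "\<dots> = comb V x + comb V y"
    using comb_eq[OF G, of x V] comb_eq[OF G, of y V] by (simp add: sum.distrib)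
  finally show ?thesis .
qed

lemma comb_scale:
  assumes "x \<in> fin_primary"
  shows "comb V (\<lambda>p. c * x p) = scaleC_op c (comb V x)"
proof -
  let ?G = "{p. x p \<noteq> 0}"
  have G: "finite ?G" using assms by (simp add: fin_primary_def)
  have "comb V (\<lambda>p. c * x p) = (\<Sum>p\<in>?G. scaleC_op (c * x p) (V p))"
    by (rule comb_eq[OF G]) auto
  then show ?thesis by (simp add: comb_def scaleC_op_sum)
qed

lemma coef_comb:
  "coef (blinfun_apply (comb V x) v) t = (\<Sum>p | x p \<noteq> 0. x p * coef (blinfun_apply (V p) v) t)"
  by (simp add: comb_def blinfun.sum_left)

lemma Alg0_sum: "finite G \<Longrightarrow> (\<And>p. p \<in> G \<Longrightarrow> V p \<in> Alg0) \<Longrightarrow> (\<Sum>p\<in>G. V p) \<in> Alg0"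
proof (induction G rule: finite_induct)
  case empty
  have "[Lg] \<in> colours" by (auto simp: colours_def intro!: exI[of _ 1])
  then have "scaleC_op 0 (T_op [Lg]) \<in> Alg0" by (intro Alg0.scale Alg0.gen)
  then show ?case by simp
qed (simp add: Alg0.add)

lemma comb_T_Alg0: "x \<in> fin_primary \<Longrightarrow> comb T_pair x \<in> Alg0"
  unfolding comb_def fin_primary_def by (auto intro!: Alg0_sum Alg0.scale T_pair_Alg0)

lemma fin_primary_single: "p \<in> primary \<Longrightarrow> (\<lambda>q. if q = p then c else 0) \<in> fin_primary"
  unfolding fin_primary_def by auto

lemma comb_single: "comb V (\<lambda>q. if q = p then c else 0) = scaleC_op c (V p)"
  by (subst comb_eq[of "{p}"]) auto

lemma comb_sum_closed:
  assumes "finite G" "\<And>i. i \<in> G \<Longrightarrow> \<exists>x\<in>fin_primary. f i = comb T_pair x"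
  shows "\<exists>x\<in>fin_primary. (\<Sum>i\<in>G. f i) = comb T_pair x"
  using assms
proof (induction G rule: finite_induct)
  case empty
  then show ?case by (intro bexI[of _ "\<lambda>_. 0"]) (simp_all add: comb_def fin_primary_def)
next
  case (insert i G)
  then obtain x y where "x \<in> fin_primary" "f i = comb T_pair x"
    "y \<in> fin_primary" "(\<Sum>i\<in>G. f i) = comb T_pair y" by (metis insertCI)
  with insert show ?case
    by (intro bexI[of _ "\<lambda>p. x p + y p"]) (simp_all add: comb_add fin_primary_add)
qed

text \<open>The combinations of nonempty products of generators form an algebra, because concatenating
  two sequences of colours again gives a product that vanishes or belongs to a primary step.\<close>

lemma Alg0_comb:
  assumes "a \<in> Alg0"
  obtains x where "x \<in> fin_primary" "a = comb T_pair x"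
proof -
  have "\<exists>x\<in>fin_primary. a = comb T_pair x" using assms
  proof induction
    case (gen c)
    have "c \<noteq> []" using gen by (auto simp: colours_def)
    then have p: "(1, c) \<in> primary" using gen by (cases c) (auto simp: primary_def)
    have "T_pair (1, c) = T_op c"
      by (rule blinfun_eqI) (simp add: T_pair_def colour_path_def colour_colour[OF gen])
    then have "T_op c = comb T_pair (\<lambda>q. if q = (1, c) then 1 else 0)"
      by (subst comb_single) (auto intro!: blinfun_eqI hilb_eqI)
    then show ?case using fin_primary_single[OF p] by blast
  next
    case (add S T)
    then show ?case using comb_add fin_primary_add by metis
  next
    case (scale T c)
    then obtain x where x: "x \<in> fin_primary" "T = comb T_pair x" by blast
    then have "(\<lambda>p. c * x p) \<in> fin_primary" by (intro fin_primary_restrict[OF x(1)]) simp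
    then show ?case using comb_scale[OF x(1)] x(2) by metis
  next
    case (mult S T)
    then obtain x y where x: "x \<in> fin_primary" "S = comb T_pair x"
      and y: "y \<in> fin_primary" "T = comb T_pair y" by blast
    have "S o\<^sub>L T = (\<Sum>p | x p \<noteq> 0. \<Sum>q | y q \<noteq> 0. scaleC_op (x p * y q) (T_pair p o\<^sub>L T_pair q))"
    proof (intro blinfun_eqI hilb_eqI)
      fix v t
      have "blinfun_apply (T_pair p) (blinfun_apply (comb T_pair y) v) =
          (\<Sum>q | y q \<noteq> 0. scaleC (y q) (blinfun_apply (T_pair p) (blinfun_apply (T_pair q) v)))"
        if "x p \<noteq> 0" for p
      proof -
        have "T_pair p \<in> BH"
        proof -
          have "p \<in> primary" using x(1) that by (auto simp: fin_primary_def)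
          then have "T_pair p \<in> Alg"
            using T_pair_Alg0 closure_subset unfolding Alg_def by blast
          then show ?thesis using Alg_subset_BH by blast
        qed
        then show ?thesis by (simp add: comb_def blinfun.sum_left blinfun.sum_right BH_scaleC)
      qed
      then show "coef (blinfun_apply (S o\<^sub>L T) v) t = coef (blinfun_apply
        (\<Sum>p | x p \<noteq> 0. \<Sum>q | y q \<noteq> 0. scaleC_op (x p * y q) (T_pair p o\<^sub>L T_pair q)) v) t"
        by (simp add: x(2) y(2) coef_comb[of _ _ "blinfun_apply (comb T_pair y) v"] blinfun.sum_left sum_distrib_left mult.assoc)
    qed
    moreover have "\<exists>z\<in>fin_primary. scaleC_op (x p * y q) (T_pair p o\<^sub>L T_pair q) = comb T_pair z"
      if "x p \<noteq> 0" for p q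
    proof -
      have "p \<in> primary" using x(1) that by (auto simp: fin_primary_def)
      then have ne: "colour_path (fst p) (snd p) @ colour_path (fst q) (snd q) \<noteq> []"
        by (auto simp: primary_def colour_path_def)
      show ?thesis
      proof (cases "T_pair p o\<^sub>L T_pair q = 0")
        case True
        then show ?thesis
          by (intro bexI[of _ "\<lambda>_. 0"])
            (auto simp: comb_def fin_primary_def intro!: blinfun_eqI hilb_eqI)
      next
        case False
        then obtain r where "r \<in> primary" "T_pair p o\<^sub>L T_pair q = T_pair r"
          using T_path_cases[OF ne] by (metis T_path_append T_pair_def)
        then show ?thesis using comb_single fin_primary_single by metis
      qed
    qed
    ultimately show ?case
      using fin_primaryD(1)[OF x(1)] fin_primaryD(1)[OF y(1)]
      by (simp only:) (intro comb_sum_closed; blast)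
  qed
  with that show ?thesis by blast
qed

section \<open>Comparison of norms\<close>

text \<open>By uniqueness of primary steps, no product of generators other than that of the
  step \<^term>\<open>p\<close> itself contributes to the coefficient at \<^term>\<open>p\<close>.\<close>

lemma coef_comb_T:
  assumes x: "x \<in> fin_primary" and p: "p \<in> primary"
  shows "coef (blinfun_apply (comb T_pair x) (basis (source p))) (snd p) = x p"
proof -
  obtain k t where kt: "p = (k, t)" by force
  have k: "k \<le> length t" using p by (simp add: kt primary_def)
  have "x q * coef (blinfun_apply (T_pair q) (basis (source p))) (snd p) =
      (if q = p then x p else 0)" if "x q \<noteq> 0" for q
  proof -
    obtain j u where q: "q = (j, u)" by force
    have "q = p" if jt: "j \<le> length t" "colour_path j t = colour_path j u" "drop j t = drop k t"
    proof -
      have "length t - j = length t - k" using jt(3) by (metis length_drop)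
      then have "j = k" using jt k by linarith
      with primary_unique[of k u t] fin_primaryD(2)[OF x \<open>x q \<noteq> 0\<close>] p jt show ?thesis
        by (simp add: kt q)
    qed
    then show ?thesis using k by (auto simp: coef_T_pair source_def kt q)
  qed
  then have "coef (blinfun_apply (comb T_pair x) (basis (source p))) (snd p) =
      (\<Sum>q | x q \<noteq> 0. if q = p then x p else 0)"
    unfolding coef_comb by (intro sum.cong) auto
  also have "\<dots> = x p" using fin_primaryD(1)[OF x] by simp
  finally show ?thesis .
qed

lemma coef_comb_unit:
  assumes x: "x \<in> fin_primary" and p: "p \<in> primary"
  shows "coef (blinfun_apply (comb unit_pair x) (basis (source p))) (snd p) = x p"
proof -
  obtain k t where kt: "p = (k, t)" by force
  have k: "k \<le> length t" using p by (simp add: kt primary_def)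
  have "x q * coef (blinfun_apply (unit_pair q) (basis (source p))) (snd p) =
      (if q = p then x p else 0)" if "x q \<noteq> 0" for q
  proof -
    obtain j u where q: "q = (j, u)" by force
    have "j \<le> length u" using fin_primaryD(2)[OF x that] by (simp add: q primary_def)
    moreover have "j = k" if "drop j t = drop k t" "j \<le> length t"
    proof -
      have "length t - j = length t - k" using that(1) by (metis length_drop)
      then show ?thesis using that k by linarith
    qed
    ultimately show ?thesis by (auto simp: coef_unit_pair source_def kt q)
  qed
  then have "coef (blinfun_apply (comb unit_pair x) (basis (source p))) (snd p) =
      (\<Sum>q | x q \<noteq> 0. if q = p then x p else 0)"
    unfolding coef_comb by (intro sum.cong) auto
  also have "\<dots> = x p" using fin_primaryD(1)[OF x] by simp
  finally show ?thesis .
qed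

lemma entry_bound:
  "cmod (coef (blinfun_apply B (basis s)) t) * (Wt t / Wt s) \<le> norm B"
proof -
  let ?v = "blinfun_apply B (basis s)"
  have "cmod (coef ?v t) * (Wt t)\<^sup>2 \<le> norm ?v * Wt t"
    using cmod_cinner_le[of ?v "basis t"]
    by (simp add: cinner_basis_right norm_basis norm_mult norm_power mult.commute)
  then have "cmod (coef ?v t) * Wt t \<le> norm ?v"
    by (simp add: power2_eq_square mult.assoc[symmetric])
  also have "\<dots> \<le> norm B * Wt s" using norm_blinfun[of B "basis s"] by (simp add: norm_basis)
  finally show ?thesis by (simp add: divide_le_eq)
qed

text \<open>The words $g^k s$ are distinct for distinct $s$, so an operator that moves mass only from $s$
  to $g^k s$ is bounded by its largest normalised coefficient.\<close>

lemma weighted_shift_norm: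
  assumes "0 \<le> C"
    and "\<And>v t. k \<le> length t \<Longrightarrow> take k t = replicate k Lg \<Longrightarrow>
      Wt t * cmod (coef (blinfun_apply B v) t) \<le> C * (Wt (drop k t) * cmod (coef v (drop k t)))"
    and "\<And>v t. \<not> (k \<le> length t \<and> take k t = replicate k Lg) \<Longrightarrow> coef (blinfun_apply B v) t = 0"
  shows "norm B \<le> C"
proof (rule norm_blinfun_bound[OF assms(1)])
  fix v
  let ?f = "\<lambda>s. (Wt s)\<^sup>2 * (cmod (coef v s))\<^sup>2"
  have "(norm (blinfun_apply B v))\<^sup>2 \<le> (C * norm v)\<^sup>2"
    unfolding norm_sq[of "blinfun_apply B v"]
  proof (rule infsum_le_finite_sums[OF coef_summable])
    fix F :: "word set" assume F: "finite F" "F \<subseteq> UNIV"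
    let ?G = "{t \<in> F. k \<le> length t \<and> take k t = replicate k Lg}"
    have inj: "inj_on (drop k) ?G"
      by (rule inj_onI) (metis (lifting) append_take_drop_id mem_Collect_eq)
    have "(\<Sum>t\<in>F. (Wt t)\<^sup>2 * (cmod (coef (blinfun_apply B v) t))\<^sup>2)
        = (\<Sum>t\<in>?G. (Wt t)\<^sup>2 * (cmod (coef (blinfun_apply B v) t))\<^sup>2)"
      using F assms(3) by (intro sum.mono_neutral_right) auto
    also have "\<dots> \<le> (\<Sum>t\<in>?G. C\<^sup>2 * ?f (drop k t))"
    proof (rule sum_mono)
      fix t assume "t \<in> ?G"
      then have "(Wt t * cmod (coef (blinfun_apply B v) t))\<^sup>2
          \<le> (C * (Wt (drop k t) * cmod (coef v (drop k t))))\<^sup>2"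
        by (intro power_mono assms(2)) auto
      then show "(Wt t)\<^sup>2 * (cmod (coef (blinfun_apply B v) t))\<^sup>2 \<le> C\<^sup>2 * ?f (drop k t)"
        by (simp add: power_mult_distrib)
    qed
    also have "\<dots> = C\<^sup>2 * sum ?f (drop k ` ?G)"
      by (simp add: sum.reindex[OF inj] sum_distrib_left)
    also have "\<dots> \<le> C\<^sup>2 * (norm v)\<^sup>2"
      unfolding norm_sq by (intro mult_left_mono finite_sum_le_infsum) (use F coef_summable in auto)
    finally show "(\<Sum>t\<in>F. (Wt t)\<^sup>2 * (cmod (coef (blinfun_apply B v) t))\<^sup>2) \<le> (C * norm v)\<^sup>2"
      by (simp add: power_mult_distrib)
  qed
  then show "norm (blinfun_apply B v) \<le> C * norm v"
    by (rule power2_le_imp_le) (simp add: assms(1))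
qed

lemma sum_half_powers_le: "finite K \<Longrightarrow> 0 \<notin> K \<Longrightarrow> (\<Sum>k\<in>K. (1 / 2 :: real) ^ k) \<le> 1"
proof -
  assume K: "finite K" "0 \<notin> K"
  have "(\<Sum>k\<in>insert 0 K. (1 / 2 :: real) ^ k) \<le> (\<Sum>k. (1 / 2) ^ k)"
    using K by (intro sum_le_suminf summable_geometric) auto
  also have "\<dots> = 2" by (simp add: suminf_geometric)
  finally show ?thesis using K by simp
qed

text \<open>The difference of the two operators consists of the coefficients at the copies of primary
  steps. It is split into its diagonals \<open>N k\<close>, each of which is a weighted shift of norm
  at most $2^{-k} m$.\<close>

lemma norm_copies_le:
  assumes x: "x \<in> fin_primary" and m: "\<And>p. x p \<noteq> 0 \<Longrightarrow> cmod (x p) * (Wt (snd p) / Wt (source p)) \<le> m"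
    and m0: "0 \<le> m"
  shows "norm (comb T_pair x - comb unit_pair x) \<le> m"
proof -
  let ?G = "{p. x p \<noteq> 0}"
  have G: "finite ?G" by (rule fin_primaryD(1)[OF x])
  define N where "N k = (\<Sum>p | p \<in> ?G \<and> fst p = k. scaleC_op (x p) (T_pair p) - scaleC_op (x p) (unit_pair p))" for k
  have "comb T_pair x - comb unit_pair x = (\<Sum>p\<in>?G. scaleC_op (x p) (T_pair p) - scaleC_op (x p) (unit_pair p))"
    by (simp add: comb_def sum_subtractf)
  also have "\<dots> = (\<Sum>k\<in>fst ` ?G. N k)"
    unfolding N_def using sum.group[OF G finite_imageI[OF G] subset_refl, symmetric] by simp
  finally have split: "comb T_pair x - comb unit_pair x = (\<Sum>k\<in>fst ` ?G. N k)" .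
  have coefN: "coef (blinfun_apply (N k) v) t = (\<Sum>p | p \<in> ?G \<and> fst p = k.
      if t \<noteq> snd p \<and> k \<le> length t \<and> colour_path k t = colour_path k (snd p) then x p * coef v (drop k t) else 0)" for k v t
  proof -
    have "coef (blinfun_apply (scaleC_op (x p) (T_pair p) - scaleC_op (x p) (unit_pair p)) v) t =
       (if t \<noteq> snd p \<and> fst p \<le> length t \<and> colour_path (fst p) t = colour_path (fst p) (snd p)
        then x p * coef v (drop (fst p) t) else 0)" if "p \<in> ?G" for p
      using fin_primaryD(2)[OF x, of p] that
      by (cases p) (auto simp: blinfun.diff_left coef_T_pair coef_unit_pair source_def primary_def)
    then show ?thesis
      unfolding N_def blinfun.sum_left coef_sum by (intro sum.cong refl) auto
  qed
  have Nk: "norm (N k) \<le> (1 / 2) ^ k * m" if "0 < k" for k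
  proof (rule weighted_shift_norm[of _ k])
    show "0 \<le> (1 / 2) ^ k * m" using m0 by simp
    fix v t
    let ?P = "\<lambda>p. p \<in> ?G \<and> fst p = k \<and> t \<noteq> snd p \<and> k \<le> length t \<and> colour_path k t = colour_path k (snd p)"
    have main: "take k t = replicate k Lg \<and> k \<le> length t \<and>
      Wt t * cmod (coef (blinfun_apply (N k) v) t) \<le> (1 / 2) ^ k * m * (Wt (drop k t) * cmod (coef v (drop k t)))"
      if p: "?P p" for p
    proof -
      have pp: "(k, snd p) \<in> primary" using p fin_primaryD(2)[OF x, of p] by (cases p) auto
      have "(k, t) \<notin> primary" using primary_unique[OF _ pp] p by auto
      then obtain u where u: "(k, u) \<in> primary" "colour_path k t = colour_path k u" "take k t = replicate k Lg"
        "Wt t / Wt (drop k t) \<le> (1 / 2) ^ k * (Wt u / Wt (drop k u))"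
        using primary_reduction[of k t] \<open>0 < k\<close> p by auto
      have uq: "q = (k, u)" if "?P q" for q
      proof -
        have "(k, snd q) \<in> primary" using that fin_primaryD(2)[OF x, of q] by (cases q) auto
        then show ?thesis using that primary_unique[OF _ u(1)] u(2) by (cases q) auto
      qed
      have Pp: "p = (k, u)" using uq[OF p] .
      have "coef (blinfun_apply (N k) v) t = (\<Sum>q | q \<in> ?G \<and> fst q = k. if q = p then x p * coef v (drop k t) else 0)"
        unfolding coefN using uq p Pp by (intro sum.cong refl) (auto split: if_splits)
      also have "\<dots> = x p * coef v (drop k t)" using p G by simp
      finally have c: "coef (blinfun_apply (N k) v) t = x p * coef v (drop k t)" .
      have "cmod (x p) * (Wt t / Wt (drop k t)) \<le> cmod (x p) * ((1 / 2) ^ k * (Wt u / Wt (drop k u)))"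
        by (rule mult_left_mono[OF u(4)]) simp
      also have "\<dots> = (1 / 2) ^ k * (cmod (x p) * (Wt (snd p) / Wt (source p)))"
        by (simp add: Pp source_def)
      also have "\<dots> \<le> (1 / 2) ^ k * m" using m[of p] p by (intro mult_left_mono) auto
      finally have "cmod (x p) * Wt t \<le> (1 / 2) ^ k * m * Wt (drop k t)"
        by (simp add: divide_le_eq)
      from mult_right_mono[OF this, of "cmod (coef v (drop k t))"]
      show ?thesis using u(3) p by (simp add: c norm_mult mult.assoc mult.left_commute)
    qed
    have zero: "coef (blinfun_apply (N k) v) t = 0" if "\<nexists>p. ?P p"
      unfolding coefN using that by (intro sum.neutral) auto
    show "Wt t * cmod (coef (blinfun_apply (N k) v) t) \<le> (1 / 2) ^ k * m * (Wt (drop k t) * cmod (coef v (drop k t)))"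
      using main zero m0 by (cases "\<exists>p. ?P p") (blast, simp)
    show "coef (blinfun_apply (N k) v) t = 0" if "\<not> (k \<le> length t \<and> take k t = replicate k Lg)"
      using main zero that by blast
  qed
  have pos: "0 \<notin> fst ` ?G" using fin_primaryD(2)[OF x] by (force simp: primary_def)
  have "norm (comb T_pair x - comb unit_pair x) \<le> (\<Sum>k\<in>fst ` ?G. norm (N k))"
    unfolding split by (rule norm_sum)
  also have "\<dots> \<le> (\<Sum>k\<in>fst ` ?G. (1 / 2) ^ k * m)" using pos by (intro sum_mono Nk) (metis gr0I)
  also have "\<dots> = (\<Sum>k\<in>fst ` ?G. (1 / 2) ^ k) * m" by (simp add: sum_distrib_right)
  also have "\<dots> \<le> 1 * m" using G pos m0 by (intro mult_right_mono sum_half_powers_le) auto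
  finally show ?thesis by simp
qed

text \<open>Both operators have the coefficient \<^term>\<open>x p\<close> at each primary step \<^term>\<open>p\<close>, so the
  norm of either one bounds the copies.\<close>

lemma norm_comb_equivalent:
  assumes x: "x \<in> fin_primary"
  shows "norm (comb T_pair x) \<le> 2 * norm (comb unit_pair x)"
    and "norm (comb unit_pair x) \<le> 2 * norm (comb T_pair x)"
proof -
  let ?T = "comb T_pair x" and ?U = "comb unit_pair x"
  have "norm (?T - ?U) \<le> norm ?U"
  proof (rule norm_copies_le[OF x])
    fix p assume "x p \<noteq> 0"
    then show "cmod (x p) * (Wt (snd p) / Wt (source p)) \<le> norm ?U"
      using entry_bound[of ?U "source p" "snd p"] coef_comb_unit[OF x fin_primaryD(2)[OF x]] by metis
  qed simp
  then show "norm ?T \<le> 2 * norm ?U" using norm_triangle_ineq2[of ?T ?U] by linarith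
  have "norm (?T - ?U) \<le> norm ?T"
  proof (rule norm_copies_le[OF x])
    fix p assume "x p \<noteq> 0"
    then show "cmod (x p) * (Wt (snd p) / Wt (source p)) \<le> norm ?T"
      using entry_bound[of ?T "source p" "snd p"] coef_comb_T[OF x fin_primaryD(2)[OF x]] by metis
  qed simp
  then show "norm ?U \<le> 2 * norm ?T"
    using norm_triangle_ineq2[of ?U ?T] norm_minus_commute[of ?T ?U] by linarith
qed

section \<open>Functionals on finite matrices\<close>

lift_definition restrict_vec :: "word set \<Rightarrow> hilb \<Rightarrow> hilb" is "\<lambda>F x s. if s \<in> F then x s else 0"
proof -
  fix F :: "word set" and x :: "word \<Rightarrow> complex"
  assume x: "(\<lambda>s. (Wt s)\<^sup>2 * (cmod (x s))\<^sup>2) summable_on UNIV"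
  show "(\<lambda>s. (Wt s)\<^sup>2 * (cmod (if s \<in> F then x s else 0))\<^sup>2) summable_on UNIV"
    by (rule summable_on_comparison_test[OF x]) auto
qed

lemma coef_restrict [simp]: "coef (restrict_vec F v) s = (if s \<in> F then coef v s else 0)"
  by transfer simp

lemma norm_add_disjoint:
  assumes "\<And>s. coef v s = 0 \<or> coef u s = 0"
  shows "(norm (v + u))\<^sup>2 = (norm v)\<^sup>2 + (norm u)\<^sup>2"
proof -
  have "cinner v u = (\<Sum>\<^sub>\<infinity>s::word. 0)"
    unfolding cinner_def using assms by (intro infsum_cong) auto
  then have "inner v u = 0" by (simp add: inner_hilb_def)
  then show ?thesis
    by (simp add: power2_norm_eq_inner inner_add_left inner_add_right inner_commute)
qed

lemma norm_restrict_split: "(norm (restrict_vec F v))\<^sup>2 + (norm (restrict_vec (- F) v))\<^sup>2 = (norm v)\<^sup>2"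
proof -
  have "restrict_vec F v + restrict_vec (- F) v = v" by (rule hilb_eqI) simp
  then show ?thesis using norm_add_disjoint[of "restrict_vec F v" "restrict_vec (- F) v"] by simp
qed

lemma norm_restrict_le: "norm (restrict_vec F v) \<le> norm v"
  using norm_restrict_split[of F v] zero_le_power2[of "norm (restrict_vec (- F) v)"]
  by - (rule power2_le_imp_le, linarith, simp)

text \<open>Adding a small operator in a disjoint set of columns, or of rows, changes the norm only to
  second order. This is what forces functionals on matrices to concentrate on finite blocks.\<close>

lemma norm_add_disjoint_sources:
  assumes "\<And>v. blinfun_apply S v = blinfun_apply S (restrict_vec F v)"
    and "\<And>v. blinfun_apply B v = blinfun_apply B (restrict_vec (- F) v)"
  shows "(norm (S + B))\<^sup>2 \<le> (norm S)\<^sup>2 + (norm B)\<^sup>2"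
proof -
  have "norm (S + B) \<le> sqrt ((norm S)\<^sup>2 + (norm B)\<^sup>2)"
  proof (rule norm_blinfun_bound)
    fix v
    let ?a = "norm (restrict_vec F v)" and ?b = "norm (restrict_vec (- F) v)"
    have "norm (blinfun_apply (S + B) v) \<le> norm S * ?a + norm B * ?b"
      unfolding blinfun.add_left assms[of v]
      by (rule order_trans[OF norm_triangle_ineq add_mono[OF norm_blinfun norm_blinfun]])
    also have "\<dots> \<le> sqrt (((norm S)\<^sup>2 + (norm B)\<^sup>2) * (?a\<^sup>2 + ?b\<^sup>2))"
    proof (rule real_le_rsqrt)
      show "(norm S * ?a + norm B * ?b)\<^sup>2 \<le> ((norm S)\<^sup>2 + (norm B)\<^sup>2) * (?a\<^sup>2 + ?b\<^sup>2)"
        using zero_le_power2[of "norm S * ?b - norm B * ?a"]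
        by (simp add: power2_eq_square algebra_simps)
    qed
    also have "\<dots> = sqrt ((norm S)\<^sup>2 + (norm B)\<^sup>2) * norm v"
      by (simp add: norm_restrict_split real_sqrt_mult)
    finally show "norm (blinfun_apply (S + B) v) \<le> sqrt ((norm S)\<^sup>2 + (norm B)\<^sup>2) * norm v" .
  qed simp
  then show ?thesis by (metis abs_norm_cancel sqrt_ge_absD)
qed

lemma norm_add_disjoint_targets:
  assumes "\<And>v. blinfun_apply S v = restrict_vec F (blinfun_apply S v)"
    and "\<And>v. blinfun_apply B v = restrict_vec (- F) (blinfun_apply B v)"
  shows "(norm (S + B))\<^sup>2 \<le> (norm S)\<^sup>2 + (norm B)\<^sup>2"
proof -
  have "norm (S + B) \<le> sqrt ((norm S)\<^sup>2 + (norm B)\<^sup>2)"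
  proof (rule norm_blinfun_bound)
    fix v
    have "coef (blinfun_apply S v) s = 0" if "s \<notin> F" for s
      by (subst assms(1)) (simp add: that)
    moreover have "coef (blinfun_apply B v) s = 0" if "s \<in> F" for s
      by (subst assms(2)) (simp add: that)
    ultimately have "coef (blinfun_apply S v) s = 0 \<or> coef (blinfun_apply B v) s = 0" for s
      by blast
    then have "(norm (blinfun_apply (S + B) v))\<^sup>2 = (norm (blinfun_apply S v))\<^sup>2 + (norm (blinfun_apply B v))\<^sup>2"
      unfolding blinfun.add_left by (rule norm_add_disjoint)
    also have "\<dots> \<le> (norm S * norm v)\<^sup>2 + (norm B * norm v)\<^sup>2"
      by (intro add_mono power_mono norm_blinfun) auto
    also have "\<dots> = (sqrt ((norm S)\<^sup>2 + (norm B)\<^sup>2) * norm v)\<^sup>2"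
      by (simp add: power_mult_distrib algebra_simps)
    finally show "norm (blinfun_apply (S + B) v) \<le> sqrt ((norm S)\<^sup>2 + (norm B)\<^sup>2) * norm v"
      by (rule power2_le_imp_le) simp
  qed simp
  then show ?thesis by (metis abs_norm_cancel sqrt_ge_absD)
qed

lemma comb_unit_restrict_source:
  assumes "\<And>p. x p \<noteq> 0 \<Longrightarrow> source p \<in> F"
  shows "blinfun_apply (comb unit_pair x) v = blinfun_apply (comb unit_pair x) (restrict_vec F v)"
  using assms by (intro hilb_eqI) (auto simp: coef_comb coef_unit_pair intro!: sum.cong)

lemma comb_unit_restrict_target:
  assumes "\<And>p. x p \<noteq> 0 \<Longrightarrow> snd p \<in> F"
  shows "blinfun_apply (comb unit_pair x) v = restrict_vec F (blinfun_apply (comb unit_pair x) v)"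
  using assms by (intro hilb_eqI) (auto simp: coef_comb coef_unit_pair intro!: sum.neutral)

definition block :: "word set \<Rightarrow> word set \<Rightarrow> (nat \<times> word \<Rightarrow> complex) \<Rightarrow> nat \<times> word \<Rightarrow> complex" where
  "block F F' x p = (if source p \<in> F \<and> snd p \<in> F' then x p else 0)"

lemma block_fin_primary: "x \<in> fin_primary \<Longrightarrow> block F F' x \<in> fin_primary"
  by (erule fin_primary_restrict) (simp add: block_def)

lemma norm_block_le:
  assumes x: "x \<in> fin_primary"
  shows "norm (comb unit_pair (block F F' x)) \<le> norm (comb unit_pair x)"
proof (rule norm_blinfun_bound)
  fix v
  have "blinfun_apply (comb unit_pair (block F F' x)) v =
      restrict_vec F' (blinfun_apply (comb unit_pair x) (restrict_vec F v))"
  proof (rule hilb_eqI)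
    fix t
    have "comb unit_pair (block F F' x) = (\<Sum>p | x p \<noteq> 0. scaleC_op (block F F' x p) (unit_pair p))"
      by (rule comb_eq[OF fin_primaryD(1)[OF x]]) (auto simp: block_def)
    then have "coef (blinfun_apply (comb unit_pair (block F F' x)) v) t =
        (\<Sum>p | x p \<noteq> 0. block F F' x p * coef (blinfun_apply (unit_pair p) v) t)"
      by (simp add: blinfun.sum_left)
    also have "\<dots> = (\<Sum>p | x p \<noteq> 0. if t \<in> F' then
        x p * coef (blinfun_apply (unit_pair p) (restrict_vec F v)) t else 0)"
      by (intro sum.cong refl) (simp add: block_def coef_unit_pair)
    also have "\<dots> = coef (restrict_vec F' (blinfun_apply (comb unit_pair x) (restrict_vec F v))) t"
      by (simp add: coef_comb)
    finally show "coef (blinfun_apply (comb unit_pair (block F F' x)) v) t =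
        coef (restrict_vec F' (blinfun_apply (comb unit_pair x) (restrict_vec F v))) t" .
  qed
  also have "norm \<dots> \<le> norm (blinfun_apply (comb unit_pair x) (restrict_vec F v))"
    by (rule norm_restrict_le)
  also have "\<dots> \<le> norm (comb unit_pair x) * norm (restrict_vec F v)" by (rule norm_blinfun)
  also have "\<dots> \<le> norm (comb unit_pair x) * norm v" by (intro mult_left_mono norm_restrict_le) simp
  finally show "norm (blinfun_apply (comb unit_pair (block F F' x)) v) \<le> norm (comb unit_pair x) * norm v" .
qed simp

lemma aligned_phase: "\<exists>c. cmod c = 1 \<and> cmod (a + c * b) = cmod a + cmod b"
proof (cases "a = 0 \<or> b = 0")
  case True
  then show ?thesis by (intro exI[of _ 1]) auto
next
  case False
  define c where "c = sgn a * cnj (sgn b)"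
  have b: "cnj (sgn b) * b = of_real (cmod b)"
  proof -
    have "cnj (sgn b) * b = (b * cnj b) / of_real (cmod b)" by (simp add: sgn_eq)
    also have "\<dots> = of_real ((cmod b)\<^sup>2 / cmod b)"
      by (simp only: complex_norm_square[symmetric] of_real_divide)
    finally show ?thesis by (simp add: power2_eq_square)
  qed
  have a: "sgn a * of_real (cmod a) = a" using False by (simp add: sgn_eq)
  have "a + c * b = sgn a * of_real (cmod a + cmod b)"
    by (simp only: of_real_add distrib_left a c_def mult.assoc b)
  then have "cmod (a + c * b) = cmod (sgn a) * cmod (complex_of_real (cmod a + cmod b))"
    by (metis norm_mult)
  then have "cmod (a + c * b) = cmod (sgn a) * (cmod a + cmod b)"
    unfolding norm_of_real by simp
  moreover have "cmod (sgn a) = 1" using False by (simp add: norm_sgn)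
  moreover have "cmod c = 1" using False by (simp add: c_def norm_mult norm_sgn)
  ultimately show ?thesis by auto
qed

text \<open>Choose a finite matrix \<open>x0\<close> in the unit ball at which the functional nearly attains its
  norm \<open>N\<close>, and let \<^term>\<open>F\<close> contain its rows and columns. If \<^term>\<open>y\<close> has norm $1$ and lives in
  other columns, or in other rows, then \<open>x0 + d y\<close> has norm at most $1 + d^2$, whereas the
  functional gains \<open>d\<close> times its modulus at \<^term>\<open>y\<close>, for a suitable phase. So this modulus is
  of order \<open>d\<close>. The part of a matrix outside the block \<^term>\<open>F\<close> is a sum of two such parts.\<close>

lemma functional_concentrates:
  fixes \<phi> :: "(nat \<times> word \<Rightarrow> complex) \<Rightarrow> complex"
  assumes add: "\<And>x y. x \<in> fin_primary \<Longrightarrow> y \<in> fin_primary \<Longrightarrow> \<phi> (\<lambda>p. x p + y p) = \<phi> x + \<phi> y"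
    and scale: "\<And>c x. x \<in> fin_primary \<Longrightarrow> \<phi> (\<lambda>p. c * x p) = c * \<phi> x"
    and bound: "\<And>x. x \<in> fin_primary \<Longrightarrow> cmod (\<phi> x) \<le> C * norm (comb unit_pair x)"
    and C: "0 \<le> C" and e: "0 < e"
  obtains F where "finite F"
    "\<And>x. x \<in> fin_primary \<Longrightarrow> cmod (\<phi> x - \<phi> (block F F x)) \<le> e * norm (comb unit_pair x)"
proof -
  let ?n = "\<lambda>x. norm (comb unit_pair x)"
  have sc_fin: "(\<lambda>p. c * x p) \<in> fin_primary" if "x \<in> fin_primary" for c x
    by (rule fin_primary_restrict[OF that]) simp
  have sc_norm: "?n (\<lambda>p. c * x p) \<le> cmod c * ?n x" if "x \<in> fin_primary" for c x
    using norm_scaleC_op_le by (simp add: comb_scale[OF that])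
  define A where "A = {cmod (\<phi> x) | x. x \<in> fin_primary \<and> ?n x \<le> 1}"
  define N where "N = Sup A"
  have ub: "a \<le> C" if aA: "a \<in> A" for a
  proof -
    obtain x where x: "x \<in> fin_primary" "?n x \<le> 1" "a = cmod (\<phi> x)" using aA unfolding A_def by blast
    have "a \<le> C * ?n x" using bound x by simp
    also have "\<dots> \<le> C" using x C by (simp add: mult_left_le)
    finally show ?thesis .
  qed
  have bdd: "bdd_above A" using ub by (auto simp: bdd_above_def)
  have zero: "(\<lambda>_. 0) \<in> fin_primary" by (simp add: fin_primary_def)
  have ne: "cmod (\<phi> (\<lambda>_. 0)) \<in> A" using zero unfolding A_def by (auto simp: comb_def)
  have N0: "0 \<le> N" unfolding N_def using cSup_upper[OF ne bdd] norm_ge_zero order_trans by blast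
  have Nb: "cmod (\<phi> x) \<le> N * ?n x" if x: "x \<in> fin_primary" for x
  proof (cases "?n x = 0")
    case True
    then show ?thesis using bound[OF x] by simp
  next
    case False
    let ?y = "\<lambda>p. complex_of_real (1 / ?n x) * x p"
    have "?n ?y \<le> 1" using sc_norm[OF x, of "complex_of_real (1 / ?n x)"] False by (simp add: norm_divide)
    then have "cmod (\<phi> ?y) \<in> A" using sc_fin[OF x] unfolding A_def by blast
    then have "cmod (\<phi> ?y) \<le> N" unfolding N_def by (rule cSup_upper[OF _ bdd])
    then have "cmod (\<phi> x) / ?n x \<le> N" unfolding scale[OF x] by (simp add: norm_mult norm_divide)
    then show ?thesis using False by (simp add: divide_le_eq)
  qed
  \<comment> \<open>The two parts outside the block contribute \<open>(N + 1) * d\<close> each.\<close>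
  define d where "d = e / (2 * (N + 1))"
  have d: "0 < d" using e N0 by (simp add: d_def)
  have "2 * N + 2 \<noteq> 0" using N0 by linarith
  then have Nd: "2 * ((N + 1) * d) = e" unfolding d_def by (simp add: divide_eq_eq)
  have "\<exists>a\<in>A. N - d\<^sup>2 < a"
    unfolding N_def using d ne by (intro less_cSupD) auto
  then obtain x0 where x0: "x0 \<in> fin_primary" "?n x0 \<le> 1" "N - d\<^sup>2 < cmod (\<phi> x0)"
    unfolding A_def by blast
  have small: "cmod (\<phi> y) \<le> (N + 1) * d * ?n y"
    if y: "y \<in> fin_primary" and sup: "\<And>c. (norm (comb unit_pair x0 + scaleC_op c (comb unit_pair y)))\<^sup>2
      \<le> (?n x0)\<^sup>2 + (norm (scaleC_op c (comb unit_pair y)))\<^sup>2" for y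
  proof (cases "?n y = 0")
    case True
    then show ?thesis using bound[OF y] by simp
  next
    case False
    obtain c where c: "cmod c = 1"
      "cmod (\<phi> x0 + c * (of_real (d / ?n y) * \<phi> y)) = cmod (\<phi> x0) + cmod (of_real (d / ?n y) * \<phi> y)"
      using aligned_phase by blast
    let ?c = "c * of_real (d / ?n y)"
    let ?z = "\<lambda>p. x0 p + ?c * y p"
    have "norm (scaleC_op ?c (comb unit_pair y)) \<le> d"
      using norm_scaleC_op_le[of ?c "comb unit_pair y"] c(1) d False by (simp add: norm_mult norm_divide)
    then have "(?n x0)\<^sup>2 + (norm (scaleC_op ?c (comb unit_pair y)))\<^sup>2 \<le> 1\<^sup>2 + d\<^sup>2"
      using x0(2) by (intro add_mono power_mono) auto
    also have "\<dots> \<le> (1 + d\<^sup>2)\<^sup>2" by (simp add: power2_sum)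
    finally have "(norm (comb unit_pair x0 + scaleC_op ?c (comb unit_pair y)))\<^sup>2 \<le> (1 + d\<^sup>2)\<^sup>2"
      using sup[of ?c] by linarith
    then have "norm (comb unit_pair x0 + scaleC_op ?c (comb unit_pair y)) \<le> 1 + d\<^sup>2"
      by (rule power2_le_imp_le) simp
    then have nz: "?n ?z \<le> 1 + d\<^sup>2"
      by (simp only: comb_add[OF x0(1) sc_fin[OF y]] comb_scale[OF y])
    have "cmod (\<phi> ?z) = cmod (\<phi> x0) + d / ?n y * cmod (\<phi> y)"
      unfolding add[OF x0(1) sc_fin[OF y]] scale[OF y] unfolding mult.assoc c(2)
      using d by (simp add: norm_mult norm_divide)
    moreover have "cmod (\<phi> ?z) \<le> N * (1 + d\<^sup>2)"
      using Nb[OF fin_primary_add[OF x0(1) sc_fin[OF y]]] mult_left_mono[OF nz N0] by (rule order_trans)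
    ultimately have "d / ?n y * cmod (\<phi> y) \<le> (N + 1) * d\<^sup>2" using x0(3) by (simp add: algebra_simps)
    then have "d * (cmod (\<phi> y) / ?n y) \<le> d * ((N + 1) * d)"
      by (simp add: power2_eq_square mult.assoc mult.left_commute)
    then have "cmod (\<phi> y) / ?n y \<le> (N + 1) * d" using d by (rule mult_left_le_imp_le)
    then show ?thesis using False by (simp add: divide_le_eq)
  qed
  define F where "F = source ` {p. x0 p \<noteq> 0} \<union> snd ` {p. x0 p \<noteq> 0}"
  show ?thesis
  proof
    show "finite F" using fin_primaryD(1)[OF x0(1)] by (simp add: F_def)
    fix x assume x: "x \<in> fin_primary"
    let ?x1 = "block (- F) UNIV x" and ?x2 = "block F (- F) x" and ?x3 = "block F F x"
    have fin: "?x1 \<in> fin_primary" "?x2 \<in> fin_primary" "?x3 \<in> fin_primary"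
      by (simp_all add: block_fin_primary x)
    have "(\<lambda>p. (?x1 p + ?x2 p) + ?x3 p) = x" by (auto simp: block_def)
    then have "\<phi> x = \<phi> ?x1 + \<phi> ?x2 + \<phi> ?x3"
      using add[OF fin_primary_add[OF fin(1,2)] fin(3)] add[OF fin(1,2)] by metis
    then have "cmod (\<phi> x - \<phi> ?x3) \<le> cmod (\<phi> ?x1) + cmod (\<phi> ?x2)"
      by (simp add: norm_triangle_ineq)
    also have "cmod (\<phi> ?x1) \<le> (N + 1) * d * ?n ?x1"
    proof (rule small[OF fin(1)])
      fix c
      show "(norm (comb unit_pair x0 + scaleC_op c (comb unit_pair ?x1)))\<^sup>2
          \<le> (?n x0)\<^sup>2 + (norm (scaleC_op c (comb unit_pair ?x1)))\<^sup>2"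
        unfolding comb_scale[OF fin(1), symmetric]
        by (rule norm_add_disjoint_sources[of _ F]; rule comb_unit_restrict_source)
          (auto simp: F_def block_def split: if_splits)
    qed
    also have "cmod (\<phi> ?x2) \<le> (N + 1) * d * ?n ?x2"
    proof (rule small[OF fin(2)])
      fix c
      show "(norm (comb unit_pair x0 + scaleC_op c (comb unit_pair ?x2)))\<^sup>2
          \<le> (?n x0)\<^sup>2 + (norm (scaleC_op c (comb unit_pair ?x2)))\<^sup>2"
        unfolding comb_scale[OF fin(2), symmetric]
        by (rule norm_add_disjoint_targets[of _ F]; rule comb_unit_restrict_target)
          (auto simp: F_def block_def split: if_splits)
    qed
    also have "(N + 1) * d * ?n ?x1 + (N + 1) * d * ?n ?x2 \<le> (N + 1) * d * ?n x + (N + 1) * d * ?n x"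
      using N0 d by (intro add_mono mult_left_mono norm_block_le[OF x]) auto
    also have "\<dots> = e * ?n x" unfolding Nd[symmetric] by (simp only: mult_2 distrib_right)
    finally show "cmod (\<phi> x - \<phi> ?x3) \<le> e * ?n x" by simp
  qed
qed

section \<open>Density of the vector functionals\<close>

lemma Alg0_subset_Alg: "Alg0 \<subseteq> Alg"
  unfolding Alg_def by (rule closure_subset)

lemma dual_comb:
  assumes f: "f \<in> Alg_dual" and x: "x \<in> fin_primary"
  shows "f (comb T_pair x) = (\<Sum>p | x p \<noteq> 0. x p * f (T_pair p))"
proof -
  have "f (0 + 0) = f 0 + f 0" using f Alg_zero unfolding Alg_dual_def by blast
  then have f0: "f 0 = 0" by simp
  have "f (\<Sum>p\<in>G. scaleC_op (x p) (T_pair p)) = (\<Sum>p\<in>G. x p * f (T_pair p))"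
    if "finite G" "G \<subseteq> primary" for G
    using that
  proof (induction G rule: finite_induct)
    case (insert p G)
    have "T_pair p \<in> Alg" using insert T_pair_Alg0 Alg0_subset_Alg by blast
    moreover have "(\<Sum>p\<in>G. scaleC_op (x p) (T_pair p)) \<in> Alg"
      using insert Alg0_subset_Alg by (intro subsetD[OF Alg0_subset_Alg] Alg0_sum Alg0.scale T_pair_Alg0) auto
    ultimately show ?case using insert f Alg_scaleC[of "T_pair p" "x p"] by (simp add: Alg_dual_def)
  qed (simp add: f0)
  then show ?thesis using x unfolding comb_def by (simp add: fin_primary_def)
qed

lemma dual_bound:
  assumes "f \<in> Alg_dual"
  obtains K where "0 \<le> K" "\<And>a. a \<in> Alg \<Longrightarrow> cmod (f a) \<le> K * norm a"
proof -
  obtain K where K: "\<And>a. a \<in> Alg \<Longrightarrow> cmod (f a) \<le> K * norm a"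
    using assms unfolding Alg_dual_def by blast
  show ?thesis
  proof (rule that[of "\<bar>K\<bar>"])
    fix a assume "a \<in> Alg"
    then have "cmod (f a) \<le> K * norm a" by (rule K)
    also have "\<dots> \<le> \<bar>K\<bar> * norm a" by (intro mult_right_mono) auto
    finally show "cmod (f a) \<le> \<bar>K\<bar> * norm a" .
  qed simp
qed

lemma dual_add_scale:
  assumes f: "f \<in> Alg_dual" and g: "g \<in> Alg_dual"
  shows "(\<lambda>a. f a + c * g a) \<in> Alg_dual"
proof -
  obtain K where K: "\<And>a. a \<in> Alg \<Longrightarrow> cmod (f a) \<le> K * norm a" using dual_bound[OF f] by blast
  obtain L where L: "\<And>a. a \<in> Alg \<Longrightarrow> cmod (g a) \<le> L * norm a" using dual_bound[OF g] by blast
  have "cmod (f a + c * g a) \<le> (K + cmod c * L) * norm a" if "a \<in> Alg" for a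
  proof -
    have "cmod (f a + c * g a) \<le> cmod (f a) + cmod c * cmod (g a)"
      using norm_triangle_ineq[of "f a" "c * g a"] by (simp add: norm_mult)
    also have "\<dots> \<le> K * norm a + cmod c * (L * norm a)"
      using K[OF that] L[OF that] by (intro add_mono mult_left_mono) auto
    finally show ?thesis by (simp add: algebra_simps)
  qed
  then have "\<exists>K. \<forall>a\<in>Alg. cmod (f a + c * g a) \<le> K * norm a" by blast
  then show ?thesis
    using f g unfolding Alg_dual_def by (intro CollectI conjI; (assumption)?) (auto simp: algebra_simps)
qed

lemma dual_zero: "(\<lambda>_. 0) \<in> Alg_dual"
  unfolding Alg_dual_def by (auto intro: exI[of _ 0])

lemma dual_scale: "f \<in> Alg_dual \<Longrightarrow> (\<lambda>a. c * f a) \<in> Alg_dual"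
  using dual_add_scale[OF dual_zero, of f c] by simp

lemma dual_add: "f \<in> Alg_dual \<Longrightarrow> g \<in> Alg_dual \<Longrightarrow> (\<lambda>a. f a + g a) \<in> Alg_dual"
  using dual_add_scale[of f g 1] by simp

lemma dual_diff: "f \<in> Alg_dual \<Longrightarrow> g \<in> Alg_dual \<Longrightarrow> (\<lambda>a. f a - g a) \<in> Alg_dual"
  using dual_add_scale[of f g "-1"] by simp

lemma dual_bound_from_Alg0:
  assumes f: "f \<in> Alg_dual" and e: "\<And>a. a \<in> Alg0 \<Longrightarrow> cmod (f a) \<le> e * norm a" and "a \<in> Alg"
  shows "cmod (f a) \<le> e * norm a"
proof -
  obtain K where K: "0 \<le> K" "\<And>a. a \<in> Alg \<Longrightarrow> cmod (f a) \<le> K * norm a" using dual_bound[OF f] by blast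
  obtain b where b: "\<And>n. b n \<in> Alg0" "b \<longlonglongrightarrow> a"
    using \<open>a \<in> Alg\<close> unfolding Alg_def closure_sequential by blast
  have "cmod (f a) \<le> e * norm (b n) + K * norm (a - b n)" for n
  proof -
    have bA: "b n \<in> Alg" using b Alg0_subset_Alg by blast
    have "a + scaleC_op (-1) (b n) = a - b n"
      by (auto intro!: blinfun_eqI hilb_eqI simp: blinfun.add_left blinfun.diff_left blinfun.minus_left)
    then have m: "a - b n \<in> Alg" using Alg_add[OF \<open>a \<in> Alg\<close> Alg_scaleC[OF bA, of "-1"]] by simp
    have "f (b n + (a - b n)) = f (b n) + f (a - b n)"
      using f bA m unfolding Alg_dual_def by blast
    then have "cmod (f a) \<le> cmod (f (b n)) + cmod (f (a - b n))" by (simp add: norm_triangle_ineq)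
    with e[OF b(1)] K(2)[OF m] show ?thesis by (meson add_mono order_trans)
  qed
  moreover have "(\<lambda>n. e * norm (b n) + K * norm (a - b n)) \<longlonglongrightarrow> e * norm a + K * norm (a - a)"
    by (intro tendsto_intros b)
  ultimately show ?thesis using LIMSEQ_le_const[of _ "e * norm a + K * norm (a - a)" "cmod (f a)"] by auto
qed

text \<open>The coefficient at a step, written as a vector functional. The scalar undoes the norm of the
  basis vector.\<close>

definition entry :: "nat \<times> word \<Rightarrow> (hilb \<Rightarrow>\<^sub>L hilb) \<Rightarrow> complex" where
  "entry p = vec_fun1 (basis (source p)) (scaleC (complex_of_real (1 / (Wt (snd p))\<^sup>2)) (basis (snd p)))"

lemma entry_eq: "a \<in> Alg \<Longrightarrow> entry p a = coef (blinfun_apply a (basis (source p))) (snd p)"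
  by (simp add: entry_def vec_fun1_def cinner_scaleC_right cinner_basis_right)

lemma dual_entries:
  assumes "finite G"
  shows "(\<lambda>a. \<Sum>p\<in>G. c p * entry p a) \<in> Alg_dual \<and>
    (\<forall>\<tau>\<in>Alg_bidual. \<tau> (\<lambda>a. \<Sum>p\<in>G. c p * entry p a) = (\<Sum>p\<in>G. c p * \<tau> (entry p)))"
  using assms
proof (induction G rule: finite_induct)
  case empty
  have "\<tau> (\<lambda>a. 0) = 0" if "\<tau> \<in> Alg_bidual" for \<tau>
    using bidual_scale[OF that dual_zero, of 0] by simp
  then show ?case using dual_zero by simp
next
  case (insert p G)
  have p: "entry p \<in> Alg_dual" unfolding entry_def by (rule vec_fun1_dual)
  note cp = dual_scale[OF p, of "c p"]
  have "\<tau> (\<lambda>a. c p * entry p a + (\<Sum>p\<in>G. c p * entry p a)) =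
      c p * \<tau> (entry p) + (\<Sum>p\<in>G. c p * \<tau> (entry p))" if "\<tau> \<in> Alg_bidual" for \<tau>
    using bidual_add[OF that cp] bidual_scale[OF that p] insert that by simp
  then show ?case using insert dual_add[OF cp] by simp
qed

text \<open>On \<^const>\<open>Alg0\<close> a functional may be regarded as one of finite matrices on the
  primary steps, bounded by the equivalence of norms. Its restriction to the finite block given by
  \<^term>\<open>G\<close> is a combination of coefficients, and the estimate extends to the closure.\<close>

lemma entries_dense:
  assumes f: "f \<in> Alg_dual" and e: "0 < e"
  obtains G where "finite G"
    "(\<lambda>a. f a - (\<Sum>p\<in>G. f (T_pair p) * entry p a)) \<in> Alg_dual"
    "Alg_dual_norm (\<lambda>a. f a - (\<Sum>p\<in>G. f (T_pair p) * entry p a)) \<le> e"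
proof -
  obtain K where K: "0 \<le> K" "\<And>a. a \<in> Alg \<Longrightarrow> cmod (f a) \<le> K * norm a" using dual_bound[OF f] by blast
  let ?\<phi> = "\<lambda>x. f (comb T_pair x)"
  have comb_Alg: "comb T_pair x \<in> Alg" if "x \<in> fin_primary" for x
    using comb_T_Alg0[OF that] Alg0_subset_Alg by blast
  obtain F where F: "finite F" "\<And>x. x \<in> fin_primary \<Longrightarrow>
      cmod (?\<phi> x - ?\<phi> (block F F x)) \<le> e / 2 * norm (comb unit_pair x)"
  proof (rule functional_concentrates[of ?\<phi> "2 * K" "e / 2"])
    fix x y assume x: "x \<in> fin_primary"
    show "?\<phi> (\<lambda>p. x p + y p) = ?\<phi> x + ?\<phi> y" if y: "y \<in> fin_primary"
      using f comb_Alg[OF x] comb_Alg[OF y] by (simp add: comb_add[OF x y] Alg_dual_def)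
    show "?\<phi> (\<lambda>p. c * x p) = c * ?\<phi> x" for c
      using f comb_Alg[OF x] by (simp add: comb_scale[OF x] Alg_dual_def)
    have "cmod (?\<phi> x) \<le> K * norm (comb T_pair x)" by (rule K(2)[OF comb_Alg[OF x]])
    also have "\<dots> \<le> K * (2 * norm (comb unit_pair x))"
      by (intro mult_left_mono norm_comb_equivalent x K)
    finally show "cmod (?\<phi> x) \<le> 2 * K * norm (comb unit_pair x)" by simp
  qed (use K e in auto)
  define G where "G = {p \<in> primary. source p \<in> F \<and> snd p \<in> F}"
  have "G \<subseteq> (\<Union>t\<in>F. (\<lambda>k. (k, t)) ` {..length t})" by (auto simp: G_def primary_def)
  then have G: "finite G" by (rule finite_subset) (use F(1) in auto)
  let ?g = "\<lambda>a. f a - (\<Sum>p\<in>G. f (T_pair p) * entry p a)"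
  have g: "?g \<in> Alg_dual" by (rule dual_diff[OF f conjunct1[OF dual_entries[OF G]]])
  have g0: "cmod (?g a) \<le> e * norm a" if a: "a \<in> Alg0" for a
  proof -
    obtain x where x: "x \<in> fin_primary" "a = comb T_pair x" by (rule Alg0_comb[OF a])
    have "?\<phi> (block F F x) = (\<Sum>p\<in>G. f (T_pair p) * entry p a)"
      unfolding dual_comb[OF f block_fin_primary[OF x(1)]]
    proof (rule sum.mono_neutral_cong_left[OF G])
      show "{p. block F F x p \<noteq> 0} \<subseteq> G"
        using fin_primaryD(2)[OF x(1)] by (auto simp: G_def block_def split: if_splits)
      have "entry p a = block F F x p" if "p \<in> G" for p
        using that coef_comb_T[OF x(1)] comb_Alg[OF x(1)] by (simp add: x(2) entry_eq G_def block_def)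
      then show "\<forall>p\<in>G - {p. block F F x p \<noteq> 0}. f (T_pair p) * entry p a = 0"
        "\<And>p. p \<in> {p. block F F x p \<noteq> 0} \<Longrightarrow> block F F x p * f (T_pair p) = f (T_pair p) * entry p a"
        using \<open>{p. block F F x p \<noteq> 0} \<subseteq> G\<close> by auto
    qed
    then have "cmod (?g a) \<le> e / 2 * norm (comb unit_pair x)" using F(2)[OF x(1)] x(2) by simp
    also have "\<dots> \<le> e / 2 * (2 * norm a)"
      using e x by (intro mult_left_mono) (simp_all add: norm_comb_equivalent)
    finally show ?thesis by simp
  qed
  have "Alg_dual_norm ?g \<le> e"
    by (rule Alg_dual_norm_le[OF dual_bound_from_Alg0[OF g g0]]) (use e in simp_all)
  then show ?thesis by (rule that[OF G g])
qed

theorem theorem5p1: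
  shows "inj_on theta Alg_bidual"
proof (rule inj_onI, rule ext)
  fix \<sigma> \<tau> f assume \<sigma>: "\<sigma> \<in> Alg_bidual" and \<tau>: "\<tau> \<in> Alg_bidual" and eq: "theta \<sigma> = theta \<tau>"
  have ent: "\<sigma> (entry p) = \<tau> (entry p)" for p
    unfolding entry_def vec_fun1_def
    using theta_cinner[OF \<sigma>] theta_cinner[OF \<tau>] eq by metis
  show "\<sigma> f = \<tau> f"
  proof (cases "f \<in> Alg_dual")
    case False
    then show ?thesis using \<sigma> \<tau> by (simp add: Alg_bidual_def)
  next
    case True
    obtain K where K: "0 \<le> K"
      "\<And>f k. f \<in> Alg_dual \<Longrightarrow> Alg_dual_norm f \<le> k \<Longrightarrow> 0 \<le> k \<Longrightarrow> cmod (\<sigma> f) \<le> K * k"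
      using bidual_bound[OF \<sigma>] by metis
    obtain L where L: "0 \<le> L"
      "\<And>f k. f \<in> Alg_dual \<Longrightarrow> Alg_dual_norm f \<le> k \<Longrightarrow> 0 \<le> k \<Longrightarrow> cmod (\<tau> f) \<le> L * k"
      using bidual_bound[OF \<tau>] by metis
    have approx: "cmod (\<sigma> f - \<tau> f) \<le> (K + L) * e" if e: "0 < e" for e
    proof -
      obtain G where G: "finite G"
        "(\<lambda>a. f a - (\<Sum>p\<in>G. f (T_pair p) * entry p a)) \<in> Alg_dual"
        "Alg_dual_norm (\<lambda>a. f a - (\<Sum>p\<in>G. f (T_pair p) * entry p a)) \<le> e"
        by (rule entries_dense[OF True e])
      let ?h = "\<lambda>a. \<Sum>p\<in>G. f (T_pair p) * entry p a"
      let ?g = "\<lambda>a. f a - ?h a"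
      note entries = dual_entries[OF G(1), of "\<lambda>p. f (T_pair p)"]
      have h: "?h \<in> Alg_dual" by (rule conjunct1[OF entries])
      have h2: "\<sigma> ?h = \<tau> ?h"
        using bspec[OF conjunct2[OF entries] \<sigma>] bspec[OF conjunct2[OF entries] \<tau>] by (simp only: ent)
      have "\<sigma> f = \<sigma> ?g + \<sigma> ?h" "\<tau> f = \<tau> ?g + \<tau> ?h"
        using bidual_add[OF \<sigma> G(2) h] bidual_add[OF \<tau> G(2) h] by simp_all
      then have "\<sigma> f - \<tau> f = \<sigma> ?g - \<tau> ?g" using h2 by simp
      then have "cmod (\<sigma> f - \<tau> f) \<le> cmod (\<sigma> ?g) + cmod (\<tau> ?g)" by (simp add: norm_triangle_ineq4)
      also have "\<dots> \<le> K * e + L * e" using e by (intro add_mono K L G) auto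
      finally show ?thesis by (simp add: distrib_right)
    qed
    have "cmod (\<sigma> f - \<tau> f) \<le> 0 + e" if "0 < e" for e
    proof -
      have "0 < e / (K + L + 1)" using that K L by simp
      then have "cmod (\<sigma> f - \<tau> f) \<le> (K + L) * (e / (K + L + 1))" by (rule approx)
      also have "\<dots> \<le> e" using that K L by (simp add: field_simps)
      finally show ?thesis by simp
    qed
    then have "cmod (\<sigma> f - \<tau> f) \<le> 0" by (rule field_le_epsilon)
    then show ?thesis by simp
  qed
qed

end
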